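(* Let $n\geq 36(k+6)$ and let $\mathcal{F}\subset \binom{[n]}{k}$ be an intersecting family. Then $\beta(\mathcal{F})\leq \binom{n-4}{k-3}$.
   Context: $\binom{[n]}{k}$ denotes the family of all $k$-element subsets of $[n]=\{1,\dots,n\}$. A family is intersecting if any two of its members have nonempty intersection. For a family $\mathcal{F}$ of subsets of $[n]$ and distinct $i,j\in[n]$, let $b_{ij}(\mathcal{F})=|\{F\in\mathcal{F}\colon i\in F,\ j\notin F\}|$; the sturdiness is $\beta(\mathcal{F})=\min_{1\leq i\neq j\leq n} b_{ij}(\mathcal{F})$. *)

theory Defs
  imports Complex_Main "HOL-Library.Ramsey"
begin

definition intersecting :: "'a set set \<Rightarrow> bool" where
  "intersecting \<F> \<longleftrightarrow> (\<forall>A\<in>\<F>. \<forall>B\<in>\<F>. A \<inter> B \<noteq> {})"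

definition pair_degree :: "nat set set \<Rightarrow> nat \<Rightarrow> nat \<Rightarrow> nat" where
  "pair_degree \<F> i j = card {F \<in> \<F>. i \<in> F \<and> j \<notin> F}"

text \<open>For \<open>n \<ge> 2\<close> the minimum is over a nonempty finite set; \<open>Min {}\<close> is unspecified,
  so \<open>sturdiness n \<F>\<close> is meaningful only for \<open>n \<ge> 2\<close>.\<close>

definition sturdiness :: "nat \<Rightarrow> nat set set \<Rightarrow> nat" where
  "sturdiness n \<F> = Min {pair_degree \<F> i j | i j. i \<in> {1..n} \<and> j \<in> {1..n} \<and> i \<noteq> j}"

text \<open>The binomial coefficient with an integer lower index, zero when that index is negative.
  On \<^typ>\<open>nat\<close> the truncated index \<open>k - 3\<close> would be \<open>0\<close> for \<open>k < 3\<close> and the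
  coefficient would be \<open>1\<close>.\<close>

definition binom :: "nat \<Rightarrow> int \<Rightarrow> nat" where
  "binom m r = (if r < 0 then 0 else m choose nat r)"

end

theory Submission
  imports Defs
begin

text \<open>Put \<open>B = binom (n - 4) (k - 3)\<close> and suppose that every pair degree exceeds \<open>B\<close>. Averaging over \<open>i\<close>
  shows that at least \<open>36 B\<close> members avoid any given vertex. If some pair \<open>x, y\<close> lies in at least \<open>4 B\<close>
  members, then by Kruskal--Katona fewer than \<open>B\<close> members avoid both, so the links of \<open>x\<close> without \<open>y\<close>
  and of \<open>y\<close> without \<open>x\<close> are large cross-intersecting families; these are almost stars with a common
  centre \<open>c\<close>, and nearly all members contain two elements of \<open>{x, y, c}\<close>. Thus pair degrees have a gap:
  they are either below \<open>4 B\<close> or very large. If all of them were below \<open>4 B\<close>, then the gap would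
  persist under shifting, so the family could be compressed; but in a compressed intersecting family
  the members avoiding the first vertex are 2-intersecting, and nearly all of them contain one fixed
  pair, a contradiction. Hence the family is close to the two-out-of-three family on some triple \<open>T\<close>, and
  by Kruskal--Katona every member meeting \<open>T\<close> in at most one point costs several members meeting \<open>T\<close>
  in two points. Summing the pair degrees of \<open>i\<close> outside and \<open>v\<close> inside \<open>T\<close> then gives an average
  of at most \<open>B\<close>.\<close>

section \<open>Shifting\<close>

text \<open>Two counts must be kept apart. \<open>pair_degree\<close> counts members containing
  \<open>i\<close> but not \<open>j\<close>, whereas the gap concerns members containing both points
  of a pair. Shifting does not preserve lower bounds on the former, as it moves members from
  \<open>j\<close> to \<open>i\<close>. What can be controlled is intersection, size and, up to the
  addition of two counts, upper bounds on the number of members through a point or a pair; so only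
  the consequence that every point is avoided often is carried into compressed families. The 36 in
  the hypothesis is 4 * 9: extending an even prefix by two elements multiplies the number of
  patterns by at most 4, prescribing one more element divides by at least 36, and a ratio of 1/9
  remains. From the \<open>36 * B\<close> members avoiding a point a shift may take
  \<open>20 * B\<close>, a second avoided point takes \<open>6 * B\<close>, and the last
  \<open>10 * B\<close> are what \<open>stable_not_light\<close> requires. The final count cannot
  lose anything in its leading term: in the two-out-of-three family the pair degrees from outside
  into the triple equal \<open>B\<close>.\<close>

definition cross_intersecting :: "'a set set \<Rightarrow> 'a set set \<Rightarrow> bool" where
  "cross_intersecting \<A> \<B> \<longleftrightarrow> (\<forall>A\<in>\<A>. \<forall>B\<in>\<B>. A \<inter> B \<noteq> {})"

lemma intersecting_iff_cross: "intersecting \<F> \<longleftrightarrow> cross_intersecting \<F> \<F>"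
  by (simp add: intersecting_def cross_intersecting_def)

lemma cross_intersecting_commute: "cross_intersecting \<A> \<B> \<longleftrightarrow> cross_intersecting \<B> \<A>"
  by (auto simp: cross_intersecting_def Int_commute)

lemma finite_nsets_subset: "finite Y \<Longrightarrow> \<F> \<subseteq> nsets Y k \<Longrightarrow> finite \<F>"
  using finite_imp_finite_nsets finite_subset by blast

definition move :: "'a \<Rightarrow> 'a \<Rightarrow> 'a set \<Rightarrow> 'a set" where
  "move i j A = insert i (A - {j})"

definition shift_set :: "'a \<Rightarrow> 'a \<Rightarrow> 'a set set \<Rightarrow> 'a set \<Rightarrow> 'a set" where
  "shift_set i j \<F> A = (if j \<in> A \<and> i \<notin> A \<and> move i j A \<notin> \<F> then move i j A else A)"

definition shift :: "'a \<Rightarrow> 'a \<Rightarrow> 'a set set \<Rightarrow> 'a set set" where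
  "shift i j \<F> = shift_set i j \<F> ` \<F>"

lemma move_inverse: "j \<in> A \<Longrightarrow> i \<notin> A \<Longrightarrow> insert j (move i j A - {i}) = A"
  by (auto simp: move_def)

lemma inj_on_shift_set: "inj_on (shift_set i j \<F>) \<F>"
proof (rule inj_onI)
  fix A B assume "A \<in> \<F>" "B \<in> \<F>" "shift_set i j \<F> A = shift_set i j \<F> B"
  then show "A = B"
    unfolding shift_set_def by (metis move_inverse)
qed

lemma card_shift [simp]: "card (shift i j \<F>) = card \<F>"
  by (simp add: shift_def card_image inj_on_shift_set)

lemma card_shift_Collect:
  "card {A \<in> shift i j \<F>. P A} = card {A \<in> \<F>. P (shift_set i j \<F> A)}"
proof -
  have "{A \<in> shift i j \<F>. P A} = shift_set i j \<F> ` {A \<in> \<F>. P (shift_set i j \<F> A)}"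
    by (auto simp: shift_def)
  moreover have "inj_on (shift_set i j \<F>) {A \<in> \<F>. P (shift_set i j \<F> A)}"
    by (rule inj_on_subset[OF inj_on_shift_set]) auto
  ultimately show ?thesis
    by (simp add: card_image)
qed

lemma move_in_nsets:
  assumes "A \<in> nsets Y k" "i \<in> Y" "j \<in> A" "i \<notin> A"
  shows "move i j A \<in> nsets Y k"
proof -
  have "finite A" "A \<subseteq> Y" "card A = k" using assms(1) by (auto simp: nsets_def)
  then have "card (move i j A) = k"
    using assms card_Suc_Diff1[of A j] by (simp add: move_def)
  then show ?thesis
    using \<open>finite A\<close> \<open>A \<subseteq> Y\<close> assms(2) by (auto simp: nsets_def move_def)
qed

lemma shift_nsets:
  assumes "\<F> \<subseteq> nsets Y k" "i \<in> Y"
  shows "shift i j \<F> \<subseteq> nsets Y k"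
  using assms move_in_nsets[of _ Y k i j] unfolding shift_def shift_set_def
  by (auto simp: subset_iff)

text \<open>Two moved sets share \<open>i\<close>. If only one moves, the other contains
  \<open>i\<close>, or avoids both \<open>i\<close> and \<open>j\<close>, or stays because its own
  shift is present; in that last case the shifted set is a member that can be tested in its
  place.\<close>

lemma cross_intersecting_shift:
  assumes "cross_intersecting \<A> \<B>" "i \<noteq> j"
  shows "cross_intersecting (shift i j \<A>) (shift i j \<B>)"
proof -
  have *: "shift_set i j \<A> A \<inter> shift_set i j \<B> B \<noteq> {}"
    if AB: "cross_intersecting \<A> \<B>" and "A \<in> \<A>" "B \<in> \<B>" "j \<in> A" "i \<notin> A" "move i j A \<notin> \<A>" 
    for A B and \<A> \<B> :: "'a set set"
  proof (cases "j \<in> B \<and> i \<notin> B \<and> move i j B \<notin> \<B>")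
    case True
    then show ?thesis using that by (auto simp: shift_set_def move_def)
  next
    case False
    have sA: "shift_set i j \<A> A = move i j A" "shift_set i j \<B> B = B"
      using that False by (auto simp: shift_set_def)
    consider "i \<in> B" | "i \<notin> B" "j \<notin> B" | "i \<notin> B" "j \<in> B" "move i j B \<in> \<B>"
      using False by blast
    then show ?thesis
    proof cases
      case 1
      then show ?thesis by (auto simp: sA move_def)
    next
      case 2
      have "A \<inter> B \<noteq> {}" using AB that by (auto simp: cross_intersecting_def)
      then show ?thesis using 2 by (auto simp: sA move_def)
    next
      case 3
      \<comment> \<open>A common point is neither \<open>i\<close>, as \<open>i \<notin> A\<close>,
        nor \<open>j\<close>, which has left \<open>B\<close>; so it also lies in
        \<open>move i j A \<inter> B\<close>.\<close>
      have "A \<inter> move i j B \<noteq> {}" using AB that 3 by (auto simp: cross_intersecting_def)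
      then show ?thesis using 3 \<open>i \<notin> A\<close> by (auto simp: sA move_def)
    qed
  qed
  have "shift_set i j \<A> A \<inter> shift_set i j \<B> B \<noteq> {}" if "A \<in> \<A>" "B \<in> \<B>" for A B
  proof (cases "j \<in> A \<and> i \<notin> A \<and> move i j A \<notin> \<A>")
    case True
    then show ?thesis using *[OF assms(1)] that by blast
  next
    case False
    show ?thesis
    proof (cases "j \<in> B \<and> i \<notin> B \<and> move i j B \<notin> \<B>")
      case True
      then show ?thesis using *[of \<B> \<A> B A] assms(1) that
        by (metis cross_intersecting_commute Int_commute)
    next
      case F2: False
      have "shift_set i j \<A> A = A" using False by (simp only: shift_set_def if_False)
      moreover have "shift_set i j \<B> B = B" using F2 by (simp only: shift_set_def if_False)
      ultimately show ?thesis
        using assms(1) that by (auto simp: cross_intersecting_def)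
    qed
  qed
  then show ?thesis by (auto simp: cross_intersecting_def shift_def)
qed

text \<open>Relative to \<open>W\<close>, so that points outside \<open>W\<close> can be kept fixed
  while the rest is compressed.\<close>

definition stable :: "nat set \<Rightarrow> nat set set \<Rightarrow> bool" where
  "stable W \<F> \<longleftrightarrow> (\<forall>A\<in>\<F>. \<forall>i\<in>W. \<forall>j\<in>W. i < j \<longrightarrow> j \<in> A \<longrightarrow> i \<notin> A \<longrightarrow> move i j A \<in> \<F>)"

lemma sum_move_less:
  fixes A :: "nat set"
  assumes "finite A" "i < j" "j \<in> A" "i \<notin> A"
  shows "\<Sum>(move i j A) < \<Sum>A"
proof -
  have "\<Sum>A = j + \<Sum>(A - {j})" using assms by (simp add: sum.remove)
  moreover have "\<Sum>(move i j A) = i + \<Sum>(A - {j})" using assms by (simp add: move_def)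
  ultimately show ?thesis using assms by simp
qed

lemma sum_shift_le:
  fixes \<F> :: "nat set set"
  assumes "finite \<F>" "\<forall>A\<in>\<F>. finite A" "i < j"
  shows "(\<Sum>A\<in>shift i j \<F>. \<Sum>A) \<le> (\<Sum>A\<in>\<F>. \<Sum>A)"
    and "A \<in> \<F> \<Longrightarrow> j \<in> A \<Longrightarrow> i \<notin> A \<Longrightarrow> move i j A \<notin> \<F> \<Longrightarrow>
      (\<Sum>A\<in>shift i j \<F>. \<Sum>A) < (\<Sum>A\<in>\<F>. \<Sum>A)"
proof -
  have eq: "(\<Sum>A\<in>shift i j \<F>. \<Sum>A) = (\<Sum>A\<in>\<F>. \<Sum>(shift_set i j \<F> A))"
    unfolding shift_def by (subst sum.reindex[OF inj_on_shift_set]) simp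
  have le: "\<Sum>(shift_set i j \<F> A) \<le> \<Sum>A" if "A \<in> \<F>" for A
    using sum_move_less[of A i j] that assms by (auto simp: shift_set_def intro: less_imp_le)
  show "(\<Sum>A\<in>shift i j \<F>. \<Sum>A) \<le> (\<Sum>A\<in>\<F>. \<Sum>A)"
    unfolding eq by (intro sum_mono le)
  assume A: "A \<in> \<F>" "j \<in> A" "i \<notin> A" "move i j A \<notin> \<F>"
  then have "\<Sum>(shift_set i j \<F> A) < \<Sum>A"
    using sum_move_less[of A i j] assms by (auto simp: shift_set_def)
  then show "(\<Sum>A\<in>shift i j \<F>. \<Sum>A) < (\<Sum>A\<in>\<F>. \<Sum>A)"
    unfolding eq using le A assms by (intro sum_strict_mono_ex1) auto
qed

text \<open>A shift that changes something lowers the total sum of elements, so any property closed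
  under shifts survives to a compressed pair. Both families are shifted together, as
  \<open>cross_intersecting_shift\<close> requires.\<close>

lemma exists_stable_pair:
  fixes \<A> \<B> :: "nat set set"
  assumes "P \<A> \<B>"
    and "\<And>\<A> \<B>. P \<A> \<B> \<Longrightarrow> finite \<A> \<and> finite \<B> \<and> (\<forall>A\<in>\<A> \<union> \<B>. finite A)"
    and step: "\<And>\<A> \<B> i j. P \<A> \<B> \<Longrightarrow> i \<in> W \<Longrightarrow> j \<in> W \<Longrightarrow> i < j \<Longrightarrow> P (shift i j \<A>) (shift i j \<B>)"
  shows "\<exists>\<A> \<B>. P \<A> \<B> \<and> stable W \<A> \<and> stable W \<B>"
  using assms(1)
proof (induction "(\<Sum>A\<in>\<A>. \<Sum>A) + (\<Sum>A\<in>\<B>. \<Sum>A)" arbitrary: \<A> \<B> rule: less_induct)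
  case less
  show ?case
  proof (cases "stable W \<A> \<and> stable W \<B>")
    case True
    then show ?thesis using less.prems by blast
  next
    case False
    then obtain A i j where A: "i \<in> W" "j \<in> W" "i < j" "j \<in> A" "i \<notin> A"
      and AB: "A \<in> \<A> \<and> move i j A \<notin> \<A> \<or> A \<in> \<B> \<and> move i j A \<notin> \<B>"
      unfolding stable_def by blast
    have fin: "finite \<A>" "finite \<B>" "\<forall>A\<in>\<A>. finite A" "\<forall>A\<in>\<B>. finite A"
      using assms(2)[OF less.prems] by auto
    have "(\<Sum>A\<in>shift i j \<A>. \<Sum>A) + (\<Sum>A\<in>shift i j \<B>. \<Sum>A) < (\<Sum>A\<in>\<A>. \<Sum>A) + (\<Sum>A\<in>\<B>. \<Sum>A)"
      using AB
    proof (elim disjE conjE)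
      assume "A \<in> \<A>" "move i j A \<notin> \<A>"
      then show ?thesis
        using sum_shift_le(2)[OF fin(1,3) A(3), of A] sum_shift_le(1)[OF fin(2,4) A(3)] A by linarith
    next
      assume "A \<in> \<B>" "move i j A \<notin> \<B>"
      then show ?thesis
        using sum_shift_le(1)[OF fin(1,3) A(3)] sum_shift_le(2)[OF fin(2,4) A(3), of A] A by linarith
    qed
    then show ?thesis
      using less.hyps step[OF less.prems A(1-3)] by blast
  qed
qed

lemma exists_stable:
  fixes \<F> :: "nat set set"
  assumes "P \<F>"
    and "\<And>\<F>. P \<F> \<Longrightarrow> finite \<F> \<and> (\<forall>A\<in>\<F>. finite A)"
    and "\<And>\<F> i j. P \<F> \<Longrightarrow> i \<in> W \<Longrightarrow> j \<in> W \<Longrightarrow> i < j \<Longrightarrow> P (shift i j \<F>)"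
  shows "\<exists>\<F>. P \<F> \<and> stable W \<F>"
proof -
  have "\<exists>\<A> \<B>. (P \<A> \<and> P \<B>) \<and> stable W \<A> \<and> stable W \<B>"
  proof (rule exists_stable_pair)
    show "P \<F> \<and> P \<F>" using assms(1) by simp
  next
    fix \<A> \<B> assume "P \<A> \<and> P \<B>"
    then show "finite \<A> \<and> finite \<B> \<and> (\<forall>A\<in>\<A> \<union> \<B>. finite A)"
      using assms(2)[of \<A>] assms(2)[of \<B>] by blast
  next
    fix \<A> \<B> i j assume "P \<A> \<and> P \<B>" "i \<in> W" "j \<in> W" "i < j"
    then show "P (shift i j \<A>) \<and> P (shift i j \<B>)"
      using assms(3) by blast
  qed
  then show ?thesis by blast
qed

section \<open>Traces and links\<close>

text \<open>One count for all degrees: \<open>S = {}\<close> counts members avoiding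
  \<open>T\<close>, \<open>S = T\<close> members containing \<open>T\<close>. The additive relations
  between them come from \<open>trace_card_split\<close>.\<close>

definition trace_card :: "'a set set \<Rightarrow> 'a set \<Rightarrow> 'a set \<Rightarrow> nat" where
  "trace_card \<F> T S = card {A \<in> \<F>. A \<inter> T = S}"

definition link :: "'a set set \<Rightarrow> 'a set \<Rightarrow> 'a set \<Rightarrow> 'a set set" where
  "link \<F> T S = (\<lambda>A. A - T) ` {A \<in> \<F>. A \<inter> T = S}"

lemma card_link: "card (link \<F> T S) = trace_card \<F> T S"
proof -
  have "inj_on (\<lambda>A. A - T) {A \<in> \<F>. A \<inter> T = S}"
    by (rule inj_onI) (metis (mono_tags, lifting) Int_Diff_Un inf_commute mem_Collect_eq)
  then show ?thesis by (simp add: link_def trace_card_def card_image)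
qed

lemma link_nsets:
  assumes "\<F> \<subseteq> nsets Y k" "finite T"
  shows "link \<F> T S \<subseteq> nsets (Y - T) (k - card S)"
proof
  fix B assume "B \<in> link \<F> T S"
  then obtain A where A: "A \<in> \<F>" "A \<inter> T = S" "B = A - T"
    by (auto simp: link_def)
  then have "finite A" "A \<subseteq> Y" "card A = k" using assms(1) by (auto simp: nsets_def)
  then show "B \<in> nsets (Y - T) (k - card S)"
    using A by (auto simp: nsets_def card_Diff_subset_Int)
qed

lemma cross_intersecting_link:
  assumes "cross_intersecting \<A> \<B>" "S \<inter> S' = {}"
  shows "cross_intersecting (link \<A> T S) (link \<B> T S')"
  unfolding cross_intersecting_def
proof (intro ballI)
  fix C D assume "C \<in> link \<A> T S" "D \<in> link \<B> T S'"
  then obtain A B where A: "A \<in> \<A>" "A \<inter> T = S" "C = A - T" and B: "B \<in> \<B>" "B \<inter> T = S'" "D = B - T"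
    by (auto simp: link_def)
  then obtain z where "z \<in> A" "z \<in> B" using assms(1) by (auto simp: cross_intersecting_def)
  moreover have "z \<notin> T" using A(2) B(2) assms(2) calculation by auto
  ultimately show "C \<inter> D \<noteq> {}" using A B by auto
qed

lemma trace_card_split:
  assumes "finite \<F>" "u \<notin> T" "S \<subseteq> T"
  shows "trace_card \<F> T S = trace_card \<F> (insert u T) S + trace_card \<F> (insert u T) (insert u S)"
proof -
  have "{A \<in> \<F>. A \<inter> insert u T = S} = {A \<in> \<F>. A \<inter> T = S \<and> u \<notin> A}"
    "{A \<in> \<F>. A \<inter> insert u T = insert u S} = {A \<in> \<F>. A \<inter> T = S \<and> u \<in> A}"
    using assms by auto
  moreover have "{A \<in> \<F>. A \<inter> T = S} = {A \<in> \<F>. A \<inter> T = S \<and> u \<notin> A} \<union> {A \<in> \<F>. A \<inter> T = S \<and> u \<in> A}"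
    by auto
  moreover have "{A \<in> \<F>. A \<inter> T = S \<and> u \<notin> A} \<inter> {A \<in> \<F>. A \<inter> T = S \<and> u \<in> A} = {}"
    by auto
  ultimately show ?thesis
    using assms by (simp add: trace_card_def card_Un_disjoint)
qed

lemma trace_card_empty [simp]: "trace_card \<F> {} {} = card \<F>"
  by (simp add: trace_card_def)

lemma trace_card_shift_outside:
  assumes "i \<notin> T" "j \<notin> T"
  shows "trace_card (shift i j \<F>) T S = trace_card \<F> T S"
proof -
  have "shift_set i j \<F> A \<inter> T = A \<inter> T" for A
    using assms by (auto simp: shift_set_def move_def)
  then show ?thesis by (simp add: trace_card_def card_shift_Collect)
qed

lemma trace_card_self: "trace_card \<F> Z Z = card {A \<in> \<F>. Z \<subseteq> A}"
proof -
  have "A \<inter> Z = Z \<longleftrightarrow> Z \<subseteq> A" for A :: "'a set" by auto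
  then show ?thesis by (simp add: trace_card_def)
qed

lemma trace_card_shift_le:
  assumes "finite \<F>" "i \<notin> Z \<or> j \<in> Z"
  shows "trace_card (shift i j \<F>) Z Z \<le> trace_card \<F> Z Z"
proof -
  have "Z \<subseteq> A" if "Z \<subseteq> shift_set i j \<F> A" for A
    using that assms(2) by (cases "j \<in> A \<and> i \<notin> A \<and> move i j A \<notin> \<F>") (auto simp: shift_set_def move_def)
  then have "{A \<in> \<F>. Z \<subseteq> shift_set i j \<F> A} \<subseteq> {A \<in> \<F>. Z \<subseteq> A}"
    by blast
  then show ?thesis
    unfolding trace_card_self card_shift_Collect using assms(1) by (intro card_mono) auto
qed

text \<open>A member that gains \<open>i\<close> contained \<open>insert j Z\<close> before. This is
  the source of every claim that a shift at most adds two degrees or two pair counts.\<close>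

lemma trace_card_shift_insert_le:
  assumes "finite \<F>" "i \<notin> Z" "j \<notin> Z"
  shows "trace_card (shift i j \<F>) (insert i Z) (insert i Z)
    \<le> trace_card \<F> (insert i Z) (insert i Z) + trace_card \<F> (insert j Z) (insert j Z)"
proof -
  have "insert i Z \<subseteq> A \<or> insert j Z \<subseteq> A" if "insert i Z \<subseteq> shift_set i j \<F> A" for A
    using that assms(2,3)
    by (cases "j \<in> A \<and> i \<notin> A \<and> move i j A \<notin> \<F>") (auto simp: shift_set_def move_def)
  then have "{A \<in> \<F>. insert i Z \<subseteq> shift_set i j \<F> A} \<subseteq>
    {A \<in> \<F>. insert i Z \<subseteq> A} \<union> {A \<in> \<F>. insert j Z \<subseteq> A}"
    by blast
  then have "trace_card (shift i j \<F>) (insert i Z) (insert i Z) \<le> 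
    card ({A \<in> \<F>. insert i Z \<subseteq> A} \<union> {A \<in> \<F>. insert j Z \<subseteq> A})"
    unfolding trace_card_self card_shift_Collect using assms(1) by (intro card_mono) auto
  also have "\<dots> \<le> trace_card \<F> (insert i Z) (insert i Z) + trace_card \<F> (insert j Z) (insert j Z)"
    unfolding trace_card_self by (rule card_Un_le)
  finally show ?thesis .
qed

section \<open>Shadows and cross-intersecting families\<close>

definition shadow :: "'a set set \<Rightarrow> 'a set set" where
  "shadow \<F> = {A - {a} | A a. A \<in> \<F> \<and> a \<in> A}"

lemma shadowI: "A \<in> \<F> \<Longrightarrow> a \<in> A \<Longrightarrow> A - {a} = B \<Longrightarrow> B \<in> shadow \<F>"
  by (auto simp: shadow_def)

lemma finite_shadow: 
  assumes "finite \<F>" "\<forall>A\<in>\<F>. finite A"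
  shows "finite (shadow \<F>)"
proof -
  have "shadow \<F> = (\<Union>A\<in>\<F>. (\<lambda>a. A - {a}) ` A)" by (auto simp: shadow_def)
  then show ?thesis using assms by simp
qed

text \<open>Of two sets exchanged by swapping \<open>i\<close> and \<open>j\<close>, the one with
  \<open>i\<close> is present afterwards if at least one was before, the one with \<open>j\<close>
  only if both were. In this form the shadow comparison is a finite case check.\<close>

lemma mem_shift:
  assumes "i \<noteq> j"
  shows "B \<in> shift i j \<G> \<longleftrightarrow>
    (if i \<in> B \<and> j \<notin> B then B \<in> \<G> \<or> move j i B \<in> \<G>
     else if j \<in> B \<and> i \<notin> B then B \<in> \<G> \<and> move i j B \<in> \<G> else B \<in> \<G>)" (is "_ \<longleftrightarrow> ?R")
proof
  assume "B \<in> shift i j \<G>"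
  then obtain A where A: "A \<in> \<G>" "B = shift_set i j \<G> A" by (auto simp: shift_def)
  show ?R
  proof (cases "j \<in> A \<and> i \<notin> A \<and> move i j A \<notin> \<G>")
    case True
    then have "B = move i j A" using A by (simp add: shift_set_def)
    moreover have "move j i (move i j A) = A" using True assms by (auto simp: move_def)
    ultimately show ?thesis using A True assms by (auto simp: move_def)
  next
    case False
    then have "B = A" unfolding A(2) shift_set_def by (simp only: if_False)
    then show ?thesis using A False by auto
  qed
next
  assume R: ?R
  show "B \<in> shift i j \<G>"
  proof (cases "B \<in> \<G>")
    case True
    then have "shift_set i j \<G> B = B" using R by (auto simp: shift_set_def split: if_splits)
    then show ?thesis using True unfolding shift_def by (metis imageI)
  next
    case False
    then have B: "i \<in> B" "j \<notin> B" "move j i B \<in> \<G>" using R by (auto split: if_splits)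
    have "move i j (move j i B) = B" using B assms by (auto simp: move_def)
    moreover have "j \<in> move j i B" "i \<notin> move j i B" using assms by (auto simp: move_def)
    ultimately have "shift_set i j \<G> (move j i B) = B" using False by (simp add: shift_set_def)
    then show ?thesis using B unfolding shift_def by (metis imageI)
  qed
qed

lemma shadow_shift_subset:
  assumes "i \<noteq> j"
  shows "shadow (shift i j \<F>) \<subseteq> shift i j (shadow \<F>)"
proof
  fix B assume "B \<in> shadow (shift i j \<F>)"
  then obtain C b where C: "C \<in> shift i j \<F>" "b \<in> C" "B = C - {b}" by (auto simp: shadow_def)
  note mC = C(1)[unfolded mem_shift[OF assms]]
  note memB = mem_shift[OF assms, of B "shadow \<F>"]
  have sh: "B \<in> shadow \<F>" if "C \<in> \<F>"
    using that C by (auto simp: shadow_def)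
  consider (a) "i \<in> B" "j \<notin> B" | (b) "j \<in> B" "i \<notin> B" | (c) "i \<in> B" "j \<in> B" | (d) "i \<notin> B" "j \<notin> B"
    by blast
  then show "B \<in> shift i j (shadow \<F>)"
  proof cases
    case a
    have "B \<in> shadow \<F> \<or> move j i B \<in> shadow \<F>"
    proof (cases "C \<in> \<F>")
      case True
      then show ?thesis using sh by blast
    next
      case False
      then have "j \<notin> C" "move j i C \<in> \<F>" using mC C a by (auto split: if_splits)
      moreover have "b \<in> move j i C" "move j i C - {b} = move j i B"
        using C a calculation by (auto simp: move_def)
      ultimately show ?thesis by (blast intro: shadowI)
    qed
    then show ?thesis using memB a by simp
  next
    case b
    have CF: "C \<in> \<F>" using mC C b by (auto split: if_splits)
    moreover have "move i j B \<in> shadow \<F>"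
    proof (cases "b = i")
      case True
      \<comment> \<open>\<open>C\<close> contains both \<open>i\<close> and \<open>j\<close>;
        deleting \<open>j\<close> instead of \<open>i\<close> produces the exchanged set.\<close>
      then have "C - {j} = move i j B" "j \<in> C" using C b assms by (auto simp: move_def)
      then show ?thesis using CF by (blast intro: shadowI)
    next
      case False
      then have "move i j C \<in> \<F>" using mC C b by (auto split: if_splits)
      moreover have "b \<in> move i j C" "move i j C - {b} = move i j B"
        using C b False by (auto simp: move_def)
      ultimately show ?thesis by (blast intro: shadowI)
    qed
    ultimately show ?thesis using memB b sh by simp
  next
    case c
    then show ?thesis using mC memB C sh by (auto split: if_splits)
  next
    case d
    have "B \<in> shadow \<F>"
    proof (cases "C \<in> \<F>")
      case True
      then show ?thesis by (rule sh)
    next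
      case False
      then have "i \<in> C" "j \<notin> C" "move j i C \<in> \<F>" using mC by (auto split: if_splits)
      moreover have "b = i" using calculation C d by auto
      moreover have "j \<in> move j i C" "move j i C - {j} = B"
        using C d calculation by (auto simp: move_def)
      ultimately show ?thesis by (blast intro: shadowI)
    qed
    then show ?thesis using memB d by simp
  qed
qed

lemma card_shadow_shift_le:
  assumes "finite \<F>" "\<forall>A\<in>\<F>. finite A" "i \<noteq> j"
  shows "card (shadow (shift i j \<F>)) \<le> card (shadow \<F>)"
proof -
  have "card (shadow (shift i j \<F>)) \<le> card (shift i j (shadow \<F>))"
    using finite_shadow[OF assms(1,2)] shadow_shift_subset[OF assms(3)]
    by (intro card_mono) (auto simp: shift_def)
  then show ?thesis by simp
qed

lemma exists_stable_small_shadow: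
  fixes \<F> :: "nat set set"
  assumes "finite W" "\<F> \<subseteq> nsets W k"
  shows "\<exists>\<G>. \<G> \<subseteq> nsets W k \<and> card \<G> = card \<F> \<and> card (shadow \<G>) \<le> card (shadow \<F>) \<and> stable W \<G>"
proof -
  let ?P = "\<lambda>\<G>. \<G> \<subseteq> nsets W k \<and> card \<G> = card \<F> \<and> card (shadow \<G>) \<le> card (shadow \<F>)"
  have fin: "finite \<G> \<and> (\<forall>A\<in>\<G>. finite A)" if "\<G> \<subseteq> nsets W k" for \<G>
    using that finite_nsets_subset[OF assms(1) that] by (auto simp: nsets_def)
  have "\<exists>\<G>. ?P \<G> \<and> stable W \<G>"
  proof (rule exists_stable)
    show "?P \<F>" using assms by simp
    show "finite \<G> \<and> (\<forall>A\<in>\<G>. finite A)" if "?P \<G>" for \<G>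
      using that fin by blast
    show "?P (shift i j \<G>)" if P: "?P \<G>" and ij: "i \<in> W" "j \<in> W" "i < j" for \<G> i j
    proof -
      have "card (shadow (shift i j \<G>)) \<le> card (shadow \<G>)"
        using P ij fin by (intro card_shadow_shift_le) auto
      then show ?thesis using P ij shift_nsets[of \<G> W k i j] by auto
    qed
  qed
  then show ?thesis by blast
qed

text \<open>Lovasz' form of the Kruskal--Katona theorem. Frankl's shifting proof of it never uses that \<open>x\<close>
  may be real, so integral \<open>x\<close> avoids generalised binomial coefficients.\<close>

lemma card_shadow_ge:
  fixes \<F> :: "nat set set"
  assumes "finite W" "\<F> \<subseteq> nsets W (Suc k)" "Suc k \<le> x" "x choose Suc k \<le> card \<F>"
  shows "x choose k \<le> card (shadow \<F>)"
  using assms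
proof (induction k arbitrary: \<F> W x)
  case 0
  then have "\<F> \<noteq> {}" by auto
  then obtain A where A: "A \<in> \<F>" by blast
  then have "card A = 1" using 0 by (auto simp: nsets_def)
  then obtain a where "a \<in> A" by (metis card.empty ex_in_conv zero_neq_one)
  then have "A - {a} \<in> shadow \<F>" using A by (auto simp: shadow_def)
  moreover have "finite (shadow \<F>)"
    using 0 finite_nsets_subset[of W \<F>] by (intro finite_shadow) (auto simp: nsets_def)
  ultimately have "card (shadow \<F>) > 0" by (auto simp: card_gt_0_iff)
  then show ?case by simp
next
  case (Suc k)
  note IHk = Suc.IH
  from Suc.prems show ?case
  proof (induction "card \<F>" arbitrary: \<F> x rule: less_induct)
    case less
    obtain \<G> where \<G>: "\<G> \<subseteq> nsets W (Suc (Suc k))" "card \<G> = card \<F>" 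
      "card (shadow \<G>) \<le> card (shadow \<F>)" "stable W \<G>"
      using exists_stable_small_shadow[OF less.prems(1,2)] by blast
    have fin: "finite \<G>" "\<forall>A\<in>\<G>. finite A"
      using \<G> less.prems(1) finite_nsets_subset by (auto simp: nsets_def)
    have "x choose Suc (Suc k) > 0" using less.prems by simp
    then have "\<G> \<noteq> {}" using less.prems \<G>(2) by auto
    then obtain A0 where A0: "A0 \<in> \<G>" by blast
    then have A0W: "A0 \<subseteq> W" "A0 \<noteq> {}" using \<G>(1) by (auto simp: nsets_def)
    define w where "w = Min W"
    have w: "w \<in> W" "\<And>v. v \<in> W \<Longrightarrow> v \<noteq> w \<Longrightarrow> w < v"
      using A0W less.prems(1) Min_in[of W] Min_le[of W] unfolding w_def by fastforce+
    have stab: "move w a A \<in> \<G>" if "A \<in> \<G>" "w \<notin> A" "a \<in> A" for A a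
    proof -
      have "a \<in> W" "a \<noteq> w" using that \<G>(1) by (auto simp: nsets_def)
      then show ?thesis using \<G>(4) that w unfolding stable_def by blast
    qed
    define G0 where "G0 = {A \<in> \<G>. w \<notin> A}"
    define G1 where "G1 = {A \<in> \<G>. w \<in> A}"
    define L where "L = (\<lambda>A. A - {w}) ` G1"
    have cardL: "card L = card G1"
      unfolding L_def by (rule card_image) (auto simp: inj_on_def G1_def)
    have LW: "L \<subseteq> nsets W (Suc k)"
      using \<G>(1) fin by (auto simp: L_def G1_def nsets_def)
    have finL: "finite L" "\<forall>A\<in>L. finite A"
      using LW less.prems(1) finite_nsets_subset by (auto simp: nsets_def)
    have "G1 \<noteq> {}"
    proof (cases "w \<in> A0")
      case True
      then show ?thesis using A0 by (auto simp: G1_def)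
    next
      case False
      obtain a where "a \<in> A0" using A0W by blast
      then have "move w a A0 \<in> G1" using stab[OF A0 False] by (auto simp: G1_def move_def)
      then show ?thesis by blast
    qed
    have "finite G1" "finite G0" using fin by (auto simp: G1_def G0_def)
    have "\<G> = G0 \<union> G1" "G0 \<inter> G1 = {}" by (auto simp: G0_def G1_def)
    then have cardG: "card \<F> = card G0 + card G1"
      using \<G>(2) \<open>finite G1\<close> \<open>finite G0\<close> card_Un_disjoint by metis
    have card1: "card G1 > 0" using \<open>G1 \<noteq> {}\<close> \<open>finite G1\<close> by (simp add: card_gt_0_iff)
    \<comment> \<open>Replacing the deleted element by \<open>w\<close> gives a member, by
      compression; so the shadow of \<open>G0\<close> already lies in the link of
      \<open>w\<close>.\<close>
    have sh0: "shadow G0 \<subseteq> L"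
    proof
      fix B assume "B \<in> shadow G0"
      then obtain A a where A: "A \<in> \<G>" "w \<notin> A" "a \<in> A" "B = A - {a}"
        by (auto simp: shadow_def G0_def)
      then have "move w a A \<in> G1" using stab[of A a] by (auto simp: G1_def move_def)
      moreover have "B = move w a A - {w}" using A by (auto simp: move_def)
      ultimately show "B \<in> L" by (auto simp: L_def)
    qed
    have sh1: "L \<union> insert w ` shadow L \<subseteq> shadow \<G>"
    proof
      fix B assume "B \<in> L \<union> insert w ` shadow L"
      then show "B \<in> shadow \<G>"
      proof
        assume "B \<in> L"
        then show ?thesis by (auto simp: L_def G1_def intro: shadowI)
      next
        assume "B \<in> insert w ` shadow L"
        then obtain A a where A: "A \<in> \<G>" "w \<in> A" "a \<in> A - {w}" "B = insert w (A - {w} - {a})"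
          by (auto simp: L_def G1_def shadow_def)
        then have "A - {a} = B" by auto
        then show ?thesis using A by (blast intro: shadowI)
      qed
    qed
    have inj: "inj_on (insert w) (shadow L)"
    proof (rule inj_onI)
      fix B C assume "B \<in> shadow L" "C \<in> shadow L" "insert w B = insert w C"
      moreover have "w \<notin> D" if "D \<in> shadow L" for D
        using that by (auto simp: shadow_def L_def)
      ultimately show "B = C" by (metis insert_ident)
    qed
    have disj: "L \<inter> insert w ` shadow L = {}" by (auto simp: L_def)
    have sum_le: "card G1 + card (shadow L) \<le> card (shadow \<G>)"
    proof -
      have "card (L \<union> insert w ` shadow L) \<le> card (shadow \<G>)"
        using sh1 finite_shadow[OF fin] by (rule card_mono[rotated])
      moreover have "card (L \<union> insert w ` shadow L) = card L + card (insert w ` shadow L)"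
        using disj finL finite_shadow[OF finL] by (intro card_Un_disjoint) auto
      ultimately show ?thesis using card_image[OF inj] cardL by simp
    qed
    obtain y where y: "x = Suc y" using less.prems by (cases x) auto
    show ?case
    proof (cases "y choose Suc k \<le> card G1")
      case True
      have "y choose k \<le> card (shadow L)"
        using IHk[of W L y] LW less.prems True cardL y by simp
      then show ?thesis using True sum_le \<G>(3) y by simp
    next
      \<comment> \<open>By Pascal \<open>G0\<close> is now too large: induction on the size of the
        family, strict since \<open>G1\<close> is nonempty, finds at least
        \<open>y choose Suc k\<close> sets in the shadow of \<open>G0\<close>, hence in
        \<open>L\<close>, against \<open>card L = card G1\<close>.\<close>
      case False
      then have *: "card G0 > y choose Suc (Suc k)" using less.prems cardG y by simp
      show ?thesis
      proof (cases "Suc (Suc k) \<le> y")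
        case True
        have "y choose Suc k \<le> card (shadow G0)"
          using less.hyps[of G0 y] less.prems True * card1 cardG \<G>(1) by (auto simp: G0_def)
        also have "\<dots> \<le> card L" using sh0 finL by (intro card_mono) auto
        finally show ?thesis using False cardL by simp
      next
        case F2: False
        \<comment> \<open>Here \<open>y choose Suc k = 1\<close>, so the failed inequality would
          make \<open>G1\<close> empty.\<close>
        then have "y = Suc k" using less.prems y by simp
        then show ?thesis using False card1 by simp
      qed
    qed
  qed
qed

section \<open>From shadows of complements to sizes of cross-intersecting families\<close>

lemma card_iterated_shadow_ge:
  fixes \<F> :: "nat set set"
  assumes "finite W" "\<F> \<subseteq> nsets W l" "l \<le> x" "x choose l \<le> card \<F>" "s \<le> l"
  shows "x choose s \<le> card {B \<in> nsets W s. \<exists>A\<in>\<F>. B \<subseteq> A}"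
  using assms
proof (induction "l - s" arbitrary: \<F> l)
  case 0
  have "B \<in> \<F>" if "B \<in> nsets W s" "A \<in> \<F>" "B \<subseteq> A" for A B
  proof -
    have "finite A" "card A = card B" using that 0 by (auto simp: nsets_def)
    then show ?thesis using that card_subset_eq[of A B] by simp
  qed
  moreover have "\<F> \<subseteq> nsets W s" using 0 by simp
  ultimately have "{B \<in> nsets W s. \<exists>A\<in>\<F>. B \<subseteq> A} = \<F>"
    by blast
  then show ?case using 0 by simp
next
  case (Suc d)
  then obtain m where m: "l = Suc m" by (cases l) auto
  have "shadow \<F> \<subseteq> nsets W m"
    using Suc.prems(2) m by (auto simp: nsets_def shadow_def)
  moreover have "x choose m \<le> card (shadow \<F>)"
    using card_shadow_ge[of W \<F> m x] Suc.prems m by simp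
  ultimately have "x choose s \<le> card {B \<in> nsets W s. \<exists>A\<in>shadow \<F>. B \<subseteq> A}"
    using Suc.hyps(1)[of m "shadow \<F>"] Suc.hyps(2) Suc.prems m by simp
  also have "\<dots> \<le> card {B \<in> nsets W s. \<exists>A\<in>\<F>. B \<subseteq> A}"
    using Suc.prems(1) finite_imp_finite_nsets by (intro card_mono) (auto simp: shadow_def)
  finally show ?case .
qed

text \<open>\<open>A\<close> meets \<open>E\<close> exactly when \<open>A\<close> is not contained
  in \<open>Y - E\<close>, so the \<open>a\<close>-subsets of the complements are forbidden for
  \<open>\<A>\<close>. If \<open>\<E>\<close> is as large as the star of all \<open>b\<close>-sets
  through \<open>r\<close> fixed points, it forbids at least as many sets as that star, which
  forbids the \<open>a\<close>-sets disjoint from the \<open>r\<close> points.\<close>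

lemma card_cross_intersecting_le:
  fixes \<A> \<E> :: "nat set set"
  assumes "finite Y" "\<A> \<subseteq> nsets Y a" "\<E> \<subseteq> nsets Y b" "cross_intersecting \<A> \<E>"
    and "a + b \<le> card Y" "r \<le> b" "(card Y - r) choose (b - r) \<le> card \<E>"
  shows "card \<A> + ((card Y - r) choose a) \<le> card Y choose a"
proof -
  define N where "N = card Y"
  define \<C> where "\<C> = (\<lambda>A. Y - A) ` \<E>"
  have \<C>: "\<C> \<subseteq> nsets Y (N - b)"
    using assms(1,3) by (auto simp: \<C>_def nsets_def N_def card_Diff_subset)
  have "inj_on (\<lambda>A. Y - A) \<E>"
    using assms(3) by (intro inj_onI) (auto simp: nsets_def)
  then have "card \<C> = card \<E>" by (simp add: \<C>_def card_image)
  moreover have "(N - r) choose (b - r) = (N - r) choose (N - b)"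
    using binomial_symmetric[of "b - r" "N - r"] assms(5,6) by (simp add: N_def)
  ultimately have "(N - r) choose (N - b) \<le> card \<C>" using assms(7) by (simp add: N_def)
  moreover have "N - b \<le> N - r" "a \<le> N - b" using assms(5,6) by (auto simp: N_def)
  ultimately have ge: "(N - r) choose a \<le> card {B \<in> nsets Y a. \<exists>A\<in>\<C>. B \<subseteq> A}"
    using card_iterated_shadow_ge[OF assms(1) \<C>] by blast
  let ?S = "{B \<in> nsets Y a. \<exists>A\<in>\<C>. B \<subseteq> A}"
  have "\<A> \<inter> ?S = {}"
    using assms(4) by (fastforce simp: \<C>_def cross_intersecting_def)
  moreover have "finite (nsets Y a)" using assms(1) finite_imp_finite_nsets by blast
  ultimately have "card \<A> + card ?S = card (\<A> \<union> ?S)"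
    using assms(2) finite_subset by (intro card_Un_disjoint[symmetric]) auto
  also have "\<dots> \<le> card (nsets Y a)"
    using assms(2) \<open>finite (nsets Y a)\<close> by (intro card_mono) auto
  also have "\<dots> = N choose a" by (simp add: N_def card_nsets)
  finally show ?thesis using ge by (simp add: N_def)
qed

section \<open>Compressed families\<close>

text \<open>Moving the last common element \<open>x\<close> of \<open>A\<close> and \<open>B\<close> to the last element \<open>y < x\<close> outside both keeps
  the negated conclusion and shrinks \<open>A \<inter> B\<close>.\<close>

lemma stable_cross_prefix_aux:
  fixes W :: "nat set"
  assumes "finite W" "stable W \<A>" "\<forall>A\<in>\<A>. A \<subseteq> W" "\<forall>A\<in>\<A>. t \<le> card (A \<inter> B)" "0 < t" "A \<in> \<A>"
  shows "\<exists>s\<in>W. card ({w\<in>W. w \<le> s} - (A \<union> B)) + t \<le> card ({w\<in>W. w \<le> s} \<inter> (A \<inter> B))"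
  using assms(6)
proof (induction "card (A \<inter> B)" arbitrary: A rule: less_induct)
  case less
  show ?case
  proof (rule ccontr)
    let ?P = "\<lambda>s. {w\<in>W. w \<le> s}"
    let ?U = "\<lambda>s. ?P s - (A \<union> B)"
    assume "\<not> ?case"
    then have viol: "card (?P s \<inter> (A \<inter> B)) < card (?U s) + t" if "s \<in> W" for s
      using that by (meson not_less)
    have AW: "A \<subseteq> W" using less.prems assms(3) by auto
    have finA: "finite A" using finite_subset[OF AW assms(1)] .
    have "card (A \<inter> B) > 0" using assms(4,5) less.prems by force
    then have ne: "A \<inter> B \<noteq> {}" by auto
    define x where "x = Max (A \<inter> B)"
    have x: "x \<in> A" "x \<in> B" "\<And>z. z \<in> A \<inter> B \<Longrightarrow> z \<le> x"
      using Max_in[OF _ ne] finA unfolding x_def by auto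
    have xW: "x \<in> W" using x AW by auto
    have "?P x \<inter> (A \<inter> B) = A \<inter> B" using x AW by auto
    then have jU: "card (A \<inter> B) < card (?U x) + t" using viol[OF xW] by simp
    moreover have "t \<le> card (A \<inter> B)" using assms(4) less.prems by auto
    ultimately have "card (?U x) > 0" by simp
    then have neU: "?U x \<noteq> {}" by (metis card.empty less_irrefl)
    have finU: "finite (?U s)" for s using assms(1) by simp
    define y where "y = Max (?U x)"
    have "y \<in> ?U x" unfolding y_def using Max_in[OF finU neU] .
    then have y: "y \<in> W" "y \<le> x" "y \<notin> A" "y \<notin> B" by auto
    have ymax: "z \<le> y" if "z \<in> ?U x" for z
      unfolding y_def using Max_ge[OF finU that] .
    have yx: "y < x" using y x by (metis le_neq_implies_less)
    define A' where "A' = move y x A"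
    have A': "A' \<in> \<A>" using assms(2) less.prems xW y x yx unfolding A'_def stable_def by blast
    have A'B: "A' \<inter> B = A \<inter> B - {x}" using y by (auto simp: A'_def move_def)
    have "card (A' \<inter> B) < card (A \<inter> B)"
      unfolding A'B using x finA by (intro card_Diff1_less) auto
    then obtain s where s: "s \<in> W" 
      and le: "card (?P s - (A' \<union> B)) + t \<le> card (?P s \<inter> (A' \<inter> B))"
      using less.hyps A' by blast
    have U': "?P s - (A' \<union> B) = ?U s - {y}" using x by (auto simp: A'_def move_def)
    show False
    proof (cases "s < y")
      case True
      have "x \<notin> ?P s" using True yx by simp
      then have "?P s \<inter> (A' \<inter> B) = ?P s \<inter> (A \<inter> B)" using A'B by blast
      moreover have "?U s - {y} = ?U s" using True by auto
      ultimately show False using le viol[OF s] U' by simp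
    next
      case sy: False
      then have "y \<in> ?U s" using y by auto
      then have cU: "card (?U s) = Suc (card (?U s - {y}))" 
        using finU by (metis card.remove)
      show False
      proof (cases "s < x")
        case True
        \<comment> \<open>No uncovered element lies between \<open>y\<close> and \<open>x\<close>,
          so up to \<open>s\<close> there are as many as up to \<open>x\<close>, and the violated
          inequality at \<open>x\<close> applies.\<close>
        have "?U s = ?U x"
        proof (intro equalityI subsetI)
          fix z assume z: "z \<in> ?U x"
          then have "z \<le> s" using ymax[OF z] sy by simp
          then show "z \<in> ?U s" using z by simp
        next
          fix z assume "z \<in> ?U s"
          then show "z \<in> ?U x" using True by simp
        qed
        moreover have "card (?P s \<inter> (A' \<inter> B)) \<le> card (A \<inter> B - {x})"
          using A'B finA by (intro card_mono) auto
        moreover have "card (A \<inter> B) = Suc (card (A \<inter> B - {x}))"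
          using x finA by (metis IntI card.remove finite_Int)
        ultimately show False using le U' cU jU by simp
      next
        case False
        then have "x \<in> ?P s \<inter> (A \<inter> B)" using xW x by auto
        moreover have "?P s \<inter> (A' \<inter> B) = ?P s \<inter> (A \<inter> B) - {x}" using A'B by auto
        ultimately have "card (?P s \<inter> (A \<inter> B)) = Suc (card (?P s \<inter> (A' \<inter> B)))"
          using finA by (metis card.remove finite_Int)
        then show False using le U' cU viol[OF s] by simp
      qed
    qed
  qed
qed

text \<open>Inclusion-exclusion inside the prefix turns uncovered against doubly covered elements
  into a sum of densities. For \<open>t = 2\<close> it makes one of the two sets exceed half of the
  prefix by at least one.\<close>

lemma stable_cross_prefix:
  fixes W :: "nat set"
  assumes "finite W" "stable W \<A>" "\<forall>A\<in>\<A>. A \<subseteq> W" "\<forall>A\<in>\<A>. t \<le> card (A \<inter> B)" "0 < t" "A \<in> \<A>"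
  shows "\<exists>s\<in>W. card {w\<in>W. w \<le> s} + t \<le> card (A \<inter> {w\<in>W. w \<le> s}) + card (B \<inter> {w\<in>W. w \<le> s})"
proof -
  obtain s where s: "s \<in> W" "card ({w\<in>W. w \<le> s} - (A \<union> B)) + t \<le> card ({w\<in>W. w \<le> s} \<inter> (A \<inter> B))"
    using stable_cross_prefix_aux[OF assms] by blast
  let ?P = "{w\<in>W. w \<le> s}"
  have fin: "finite ?P" using assms(1) by simp
  have "card (A \<inter> ?P) + card (B \<inter> ?P) = card ((A \<inter> ?P) \<union> (B \<inter> ?P)) + card ((A \<inter> ?P) \<inter> (B \<inter> ?P))"
    using fin by (intro card_Un_Int) auto
  moreover have "(A \<inter> ?P) \<inter> (B \<inter> ?P) = ?P \<inter> (A \<inter> B)" by auto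
  moreover have "card ?P = card ((A \<inter> ?P) \<union> (B \<inter> ?P)) + card (?P - (A \<union> B))"
  proof -
    have "?P = ((A \<inter> ?P) \<union> (B \<inter> ?P)) \<union> (?P - (A \<union> B))" by auto
    moreover have "((A \<inter> ?P) \<union> (B \<inter> ?P)) \<inter> (?P - (A \<union> B)) = {}" by auto
    moreover have "finite ((A \<inter> ?P) \<union> (B \<inter> ?P))" "finite (?P - (A \<union> B))" using fin by auto
    ultimately show ?thesis by (metis (no_types, lifting) card_Un_disjoint)
  qed
  ultimately show ?thesis using s by (intro bexI[of _ s]) auto
qed

section \<open>Initial segments and a ballot-type union bound\<close>

definition prefix_of :: "nat set \<Rightarrow> nat set \<Rightarrow> bool" where
  "prefix_of W P \<longleftrightarrow> P \<subseteq> W \<and> (\<forall>p\<in>P. \<forall>w\<in>W. w \<le> p \<longrightarrow> w \<in> P)"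

lemma prefix_of_linear:
  assumes "prefix_of W P" "prefix_of W Q"
  shows "P \<subseteq> Q \<or> Q \<subseteq> P"
proof (rule ccontr)
  assume "\<not> ?thesis"
  then obtain p q where "p \<in> P" "p \<notin> Q" "q \<in> Q" "q \<notin> P" by blast
  then show False
    using assms unfolding prefix_of_def by (metis linear subsetD)
qed

lemma prefix_of_subset:
  assumes "prefix_of W P" "prefix_of W Q" "finite W" "card P \<le> card Q"
  shows "P \<subseteq> Q"
proof -
  have "finite P" "finite Q" using assms by (auto simp: prefix_of_def intro: finite_subset)
  then show ?thesis using prefix_of_linear[OF assms(1,2)] assms(4) card_seteq by blast
qed

lemma prefix_of_exists:
  assumes "finite W" "q \<le> card W"
  shows "\<exists>P. prefix_of W P \<and> card P = q"
  using assms
proof (induction "card W - q" arbitrary: W)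
  case 0
  then show ?case by (intro exI[of _ W]) (auto simp: prefix_of_def)
next
  case (Suc d)
  then have "W \<noteq> {}" by auto
  define m where "m = Max W"
  have m: "m \<in> W" "\<And>w. w \<in> W \<Longrightarrow> w \<le> m" 
    using Suc.prems \<open>W \<noteq> {}\<close> by (auto simp: m_def)
  have cm: "card (W - {m}) = card W - 1" using m Suc.prems by simp
  have "d = card (W - {m}) - q" "q \<le> card (W - {m})"
    unfolding cm using Suc.hyps(2) by linarith+
  then obtain P where P: "prefix_of (W - {m}) P" "card P = q"
    using Suc.hyps(1)[of "W - {m}"] Suc.prems by auto
  have "prefix_of W P"
    unfolding prefix_of_def
  proof (intro conjI ballI impI)
    show "P \<subseteq> W" using P by (auto simp: prefix_of_def)
    fix p w assume pw: "p \<in> P" "w \<in> W" "w \<le> p"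
    then have "p \<in> W" "p \<noteq> m" using P by (auto simp: prefix_of_def)
    then have "w \<noteq> m" using pw m(2)[of p] by auto
    then show "w \<in> P" using P pw by (auto simp: prefix_of_def)
  qed
  then show ?case using P by blast
qed

text \<open>Rounding the prefix down to even length \<open>2 * j\<close> drops at most one point,
  and for odd length parity supplies the surplus that pays for it. Only one event per
  \<open>j\<close> then has to be counted.\<close>

lemma ballot_even:
  assumes "finite W" "s \<in> W" "card {w\<in>W. w \<le> s} + 2 \<le> 2 * card (A \<inter> {w\<in>W. w \<le> s})"
    and P: "\<And>q. q \<le> card W \<Longrightarrow> prefix_of W (P q) \<and> card (P q) = q"
  shows "\<exists>j\<ge>1. 2 * j \<le> card W \<and> Suc j \<le> card (A \<inter> P (2 * j))"
proof -
  let ?Q = "{w\<in>W. w \<le> s}"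
  define q where "q = card ?Q"
  have pQ: "prefix_of W ?Q" by (auto simp: prefix_of_def)
  have fQ: "finite ?Q" using assms(1) by simp
  have qW: "q \<le> card W" unfolding q_def using assms(1) by (intro card_mono) auto
  define j where "j = q div 2"
  have jW: "2 * j \<le> card W" "2 * j \<le> q" "q \<le> Suc (2 * j)" using qW by (auto simp: j_def)
  have PQ: "P (2 * j) \<subseteq> ?Q"
    using P[OF jW(1)] jW(2) pQ assms(1) by (intro prefix_of_subset[of W]) (auto simp: q_def)
  have "card (A \<inter> ?Q) \<le> card ?Q" using fQ by (intro card_mono) auto
  then have "q \<ge> 2" using assms(3) by (simp add: q_def)
  then have "j \<ge> 1" by (simp add: j_def)
  have "card (?Q - P (2 * j)) = q - 2 * j"
    using PQ fQ P[OF jW(1)] finite_subset[OF PQ fQ] by (simp add: card_Diff_subset q_def)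
  moreover have "card (A \<inter> ?Q) \<le> card (A \<inter> P (2 * j)) + card (?Q - P (2 * j))"
  proof -
    have "A \<inter> ?Q \<subseteq> (A \<inter> P (2 * j)) \<union> (?Q - P (2 * j))" by auto
    then have "card (A \<inter> ?Q) \<le> card ((A \<inter> P (2 * j)) \<union> (?Q - P (2 * j)))"
      using fQ finite_subset[OF PQ fQ] by (intro card_mono) auto
    then show ?thesis using card_Un_le order_trans by blast
  qed
  ultimately have "card (A \<inter> ?Q) + 2 * j \<le> card (A \<inter> P (2 * j)) + q" using jW by linarith
  moreover have "q + 2 \<le> 2 * card (A \<inter> ?Q)" using assms(3) by (simp add: q_def)
  ultimately have "Suc j \<le> card (A \<inter> P (2 * j))"
    using jW by linarith
  then show ?thesis using \<open>j \<ge> 1\<close> jW by blast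
qed

lemma card_supersets_le:
  assumes "finite W" "J \<subseteq> W" "card J \<le> K"
  shows "card {A \<in> nsets W K. J \<subseteq> A} \<le> (card W - card J) choose (K - card J)"
proof -
  have finJ: "finite J" using assms finite_subset by blast
  have "{A \<in> nsets W K. J \<subseteq> A} \<subseteq> (\<lambda>B. B \<union> J) ` nsets (W - J) (K - card J)"
  proof
    fix A assume A: "A \<in> {A \<in> nsets W K. J \<subseteq> A}"
    then have "A - J \<in> nsets (W - J) (K - card J)"
      using finJ by (auto simp: nsets_def card_Diff_subset)
    moreover have "A = (A - J) \<union> J" using A by auto
    ultimately show "A \<in> (\<lambda>B. B \<union> J) ` nsets (W - J) (K - card J)" by blast
  qed
  then have "card {A \<in> nsets W K. J \<subseteq> A} \<le> card (nsets (W - J) (K - card J))"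
    using assms(1) by (meson surj_card_le finite_imp_finite_nsets finite_Diff)
  also have "\<dots> = (card W - card J) choose (K - card J)"
    using assms finJ by (simp add: card_nsets card_Diff_subset)
  finally show ?thesis .
qed

text \<open>Union bound for \<open>K\<close>-sets with more than \<open>j\<close> elements in a
  fixed \<open>2 * j\<close>-set: prescribe \<open>Suc j\<close> of these elements and extend
  freely.\<close>

definition ballot_bound :: "nat \<Rightarrow> nat \<Rightarrow> nat \<Rightarrow> nat" where
  "ballot_bound N K j = ((2 * j) choose Suc j) * ((N - Suc j) choose (K - Suc j))"

lemma card_ballot_level_le:
  assumes "finite W" "P \<subseteq> W" "card P = 2 * j" "Suc j \<le> K"
  shows "card {A \<in> nsets W K. Suc j \<le> card (A \<inter> P)} \<le> ballot_bound (card W) K j"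
proof -
  have finP: "finite P" using assms finite_subset by blast
  let ?S = "\<lambda>J. {A \<in> nsets W K. J \<subseteq> A}"
  have "{A \<in> nsets W K. Suc j \<le> card (A \<inter> P)} \<subseteq> (\<Union>J\<in>nsets P (Suc j). ?S J)"
  proof
    fix A assume A: "A \<in> {A \<in> nsets W K. Suc j \<le> card (A \<inter> P)}"
    then obtain J where "J \<subseteq> A \<inter> P" "card J = Suc j" 
      using obtain_subset_with_card_n by (metis (no_types, lifting) mem_Collect_eq)
    then have "J \<in> nsets P (Suc j)" "J \<subseteq> A"
      using finP finite_subset[of J P] by (auto simp: nsets_def)
    then show "A \<in> (\<Union>J\<in>nsets P (Suc j). ?S J)" using A by blast
  qed
  then have "card {A \<in> nsets W K. Suc j \<le> card (A \<inter> P)} \<le> card (\<Union>J\<in>nsets P (Suc j). ?S J)"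
    using finP assms(1) by (intro card_mono) (simp_all add: finite_imp_finite_nsets)
  also have "\<dots> \<le> (\<Sum>J\<in>nsets P (Suc j). card (?S J))"
    using finP finite_imp_finite_nsets by (intro card_UN_le) auto
  also have "\<dots> \<le> (\<Sum>J\<in>nsets P (Suc j). (card W - Suc j) choose (K - Suc j))"
  proof (rule sum_mono)
    fix J assume J: "J \<in> nsets P (Suc j)"
    then have "J \<subseteq> W" "card J = Suc j" using assms(2) by (auto simp: nsets_def)
    then show "card (?S J) \<le> (card W - Suc j) choose (K - Suc j)"
      using card_supersets_le[OF assms(1), of J K] assms(4) by simp
  qed
  also have "\<dots> = ballot_bound (card W) K j"
    using assms(3) by (simp add: ballot_bound_def card_nsets)
  finally show ?thesis .
qed

text \<open>The exact ratio is \<open>(2 * j + 2) * (2 * j + 1) / (j * (j + 2))\<close>, which is at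
  most 4 for \<open>j \<ge> 1\<close> with equality at \<open>j = 1\<close>.\<close>

lemma binomial_middle_step: "(2 * Suc j) choose Suc (Suc j) \<le> 4 * ((2 * j) choose Suc j)" if "j \<ge> 1"
proof -
  have 1: "Suc (Suc j) * ((2 * j + 1) choose Suc (Suc j)) = j * ((2 * j + 1) choose Suc j)"
    using binomial_absorb_comp[of "2 * j + 1" "Suc j"] Suc_times_binomial_eq[of "2*j" "Suc j"]
    by (simp add: algebra_simps)
  have 2: "(2 * Suc j) choose Suc (Suc j) = ((2 * j + 1) choose Suc j) + ((2 * j + 1) choose Suc (Suc j))"
    by simp
  have 3: "j * ((2 * j + 1) choose Suc j) = Suc (2 * j) * ((2 * j) choose Suc j)"
    using binomial_absorb_comp[of "2 * j + 1" "Suc j"] by (simp add: algebra_simps)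
  define a b c d where "a = (2 * j) choose Suc j" and "b = (2 * j + 1) choose Suc j"
    and "c = (2 * j + 1) choose Suc (Suc j)" and "d = (2 * Suc j) choose Suc (Suc j)"
  note eqs = 1 2 3
  have e: "Suc (Suc j) * c = j * b" "d = b + c" "j * b = Suc (2 * j) * a"
    using eqs unfolding a_def b_def c_def d_def by simp_all
  have "(j * Suc (Suc j)) * d = Suc (Suc j) * (j * b) + j * (Suc (Suc j) * c)"
    unfolding e(2) by (simp only: algebra_simps)
  also have "\<dots> = (2 * j + 2) * (j * b)"
    unfolding e(1) by (simp add: algebra_simps)
  also have "\<dots> = ((2 * j + 2) * Suc (2 * j)) * a"
    unfolding e(3) by (simp only: mult.assoc)
  also have "\<dots> \<le> (j * Suc (Suc j) * 4) * a"
    using that by (intro mult_right_mono) (auto simp: algebra_simps)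
  finally have "(j * Suc (Suc j)) * d \<le> (j * Suc (Suc j)) * (4 * a)"
    by (simp only: mult.assoc)
  then have "d \<le> 4 * a" using that by simp
  then show ?thesis by (simp only: a_def d_def)
qed

text \<open>The quotient of the two coefficients is \<open>(K - j) / (N - j)\<close>, at most
  \<open>K / N\<close> since \<open>K \<le> N\<close>.\<close>

lemma binomial_drop_both:
  assumes "36 * K \<le> N" "j < K"
  shows "36 * ((N - Suc j) choose (K - Suc j)) \<le> (N - j) choose (K - j)"
proof -
  obtain M k where M: "N - j = Suc M" "K - j = Suc k"
    using assms by (metis Suc_diff_Suc less_le_trans mult_le_mono2 nat_mult_1 one_le_numeral mult_le_mono1 order_trans)
  then have "N - Suc j = M" "K - Suc j = k" by linarith+
  moreover have "36 * Suc k \<le> Suc M"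
  proof -
    have "K = j + Suc k" "N = j + Suc M" using assms(2) M by linarith+
    then show ?thesis using assms(1) by simp
  qed
  moreover have "Suc k * (Suc M choose Suc k) = Suc M * (M choose k)" 
    by (simp only: Suc_times_binomial)
  ultimately have "(36 * Suc k) * (M choose k) \<le> Suc k * (Suc M choose Suc k)"
    by (metis mult_le_mono1)
  then have "Suc k * (36 * (M choose k)) \<le> Suc k * (Suc M choose Suc k)"
    by (simp only: mult.assoc mult.left_commute)
  then have "36 * (M choose k) \<le> Suc M choose Suc k" by (simp only: Suc_mult_le_cancel1)
  then show ?thesis using M \<open>N - Suc j = M\<close> \<open>K - Suc j = k\<close> by simp
qed

lemma sum_geometric_le:
  fixes h :: "nat \<Rightarrow> nat"
  assumes "\<And>j. j0 \<le> j \<Longrightarrow> Suc j < K \<Longrightarrow> 9 * h (Suc j) \<le> h j" "j0 < K"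
  shows "8 * (\<Sum>j=j0..<K. h j) \<le> 9 * h j0"
proof -
  \<comment> \<open>The extra \<open>h m\<close> on the left pays for the next summand:
    \<open>8 * h (Suc m) + h (Suc m) \<le> h m\<close>.\<close>
  have "m < K \<longrightarrow> 8 * (\<Sum>j=j0..<Suc m. h j) + h m \<le> 9 * h j0" if "j0 \<le> m" for m
    using that
  proof (induction m rule: dec_induct)
    case base
    then show ?case by simp
  next
    case (step m)
    show ?case
    proof
      assume "Suc m < K"
      then show "8 * (\<Sum>j=j0..<Suc (Suc m). h j) + h (Suc m) \<le> 9 * h j0"
        using step assms(1)[of m] by simp
    qed
  qed
  moreover obtain m where "K = Suc m" "j0 \<le> m" using assms(2) by (cases K) auto
  ultimately show ?thesis by fastforce
qed

lemma card_ballot_le: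
  assumes "finite W" "36 * K \<le> card W" "1 \<le> j0" "j0 < K"
    and P: "\<And>q. q \<le> card W \<Longrightarrow> prefix_of W (P q) \<and> card (P q) = q"
  shows "8 * card {A \<in> nsets W K. \<exists>j\<ge>j0. 2 * j \<le> card W \<and> Suc j \<le> card (A \<inter> P (2 * j))}
    \<le> 9 * ballot_bound (card W) K j0"
proof -
  have fn: "finite (nsets W K)" using assms(1) finite_imp_finite_nsets by blast
  let ?S = "\<lambda>j. {A \<in> nsets W K. Suc j \<le> card (A \<inter> P (2 * j))}"
  have "{A \<in> nsets W K. \<exists>j\<ge>j0. 2 * j \<le> card W \<and> Suc j \<le> card (A \<inter> P (2 * j))} \<subseteq> (\<Union>j\<in>{j0..<K}. ?S j)"
  proof
    fix A assume "A \<in> {A \<in> nsets W K. \<exists>j\<ge>j0. 2 * j \<le> card W \<and> Suc j \<le> card (A \<inter> P (2 * j))}"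
    then obtain j where j: "A \<in> nsets W K" "j \<ge> j0" "Suc j \<le> card (A \<inter> P (2 * j))" by blast
    then have "finite A" "card A = K" by (auto simp: nsets_def)
    then have "card (A \<inter> P (2 * j)) \<le> K" using card_mono[of A "A \<inter> P (2 * j)"] by simp
    then show "A \<in> (\<Union>j\<in>{j0..<K}. ?S j)" using j by auto
  qed
  then have "card {A \<in> nsets W K. \<exists>j\<ge>j0. 2 * j \<le> card W \<and> Suc j \<le> card (A \<inter> P (2 * j))}
     \<le> card (\<Union>j\<in>{j0..<K}. ?S j)"
    using fn by (intro card_mono) auto
  also have "\<dots> \<le> (\<Sum>j=j0..<K. card (?S j))" by (intro card_UN_le) auto
  also have "\<dots> \<le> (\<Sum>j=j0..<K. ballot_bound (card W) K j)"
  proof (rule sum_mono)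
    fix j assume "j \<in> {j0..<K}"
    then have "2 * j \<le> card W" "Suc j \<le> K" using assms(2) by auto
    then show "card (?S j) \<le> ballot_bound (card W) K j"
      using P[of "2 * j"] assms(1) by (intro card_ballot_level_le) (auto simp: prefix_of_def)
  qed
  finally have *: "card {A \<in> nsets W K. \<exists>j\<ge>j0. 2 * j \<le> card W \<and> Suc j \<le> card (A \<inter> P (2 * j))}
     \<le> (\<Sum>j=j0..<K. ballot_bound (card W) K j)" .
  have "9 * ballot_bound (card W) K (Suc j) \<le> ballot_bound (card W) K j"
    if "j0 \<le> j" "Suc j < K" for j
  proof -
    have "9 * ballot_bound (card W) K (Suc j) =
        9 * (((2 * Suc j) choose Suc (Suc j)) * ((card W - Suc (Suc j)) choose (K - Suc (Suc j))))"
      by (simp add: ballot_bound_def)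
    also have "\<dots> \<le> 9 * ((4 * ((2 * j) choose Suc j)) * ((card W - Suc (Suc j)) choose (K - Suc (Suc j))))"
      using binomial_middle_step[of j] that assms(3) by (intro mult_le_mono mult_le_mono1 order_refl) auto
    also have "\<dots> = ((2 * j) choose Suc j) * (36 * ((card W - Suc (Suc j)) choose (K - Suc (Suc j))))"
      by simp
    also have "\<dots> \<le> ((2 * j) choose Suc j) * ((card W - Suc j) choose (K - Suc j))"
      using binomial_drop_both[of K "card W" "Suc j"] assms(2) that by (intro mult_le_mono2) auto
    finally show ?thesis by (simp add: ballot_bound_def)
  qed
  then have "8 * (\<Sum>j=j0..<K. ballot_bound (card W) K j) \<le> 9 * ballot_bound (card W) K j0"
    using assms(4) by (intro sum_geometric_le) auto
  then show ?thesis using * by linarith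
qed

lemma card_stable_cross_2_intersecting_le:
  fixes W :: "nat set"
  assumes "finite W" "36 * K \<le> card W" "2 \<le> K"
    and "\<A> \<subseteq> nsets W K" "\<B> \<subseteq> nsets W K" "stable W \<A>"
    and "\<forall>A\<in>\<A>. \<forall>B\<in>\<B>. 2 \<le> card (A \<inter> B)"
  shows "8 * card \<A> \<le> 9 * ((card W - 2) choose (K - 2)) \<or> 8 * card \<B> \<le> 9 * ((card W - 2) choose (K - 2))"
proof -
  have "\<forall>q. \<exists>P. q \<le> card W \<longrightarrow> prefix_of W P \<and> card P = q"
    using prefix_of_exists[OF assms(1)] by blast
  then obtain P where P: "\<And>q. q \<le> card W \<Longrightarrow> prefix_of W (P q) \<and> card (P q) = q" by metis
  let ?R = "\<lambda>A. \<exists>s\<in>W. card {w\<in>W. w \<le> s} + 2 \<le> 2 * card (A \<inter> {w\<in>W. w \<le> s})"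
  let ?E = "{A \<in> nsets W K. \<exists>j\<ge>1. 2 * j \<le> card W \<and> Suc j \<le> card (A \<inter> P (2 * j))}"
  have "8 * card ?E \<le> 9 * ballot_bound (card W) K 1"
    using assms P by (intro card_ballot_le) auto
  moreover have "ballot_bound (card W) K 1 = (card W - 2) choose (K - 2)"
    by (simp add: ballot_bound_def numeral_2_eq_2)
  ultimately have E: "8 * card ?E \<le> 9 * ((card W - 2) choose (K - 2))" by simp
  have le: "8 * card \<C> \<le> 9 * ((card W - 2) choose (K - 2))"
    if sub: "\<C> \<subseteq> nsets W K" and R: "\<And>A. A \<in> \<C> \<Longrightarrow> ?R A" for \<C>
  proof -
    have "\<C> \<subseteq> ?E"
    proof
      fix A assume A: "A \<in> \<C>"
      obtain s where s: "s \<in> W" "card {w\<in>W. w \<le> s} + 2 \<le> 2 * card (A \<inter> {w\<in>W. w \<le> s})"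
        using R[OF A] by (elim bexE)
      have "\<exists>j\<ge>1. 2 * j \<le> card W \<and> Suc j \<le> card (A \<inter> P (2 * j))"
        by (rule ballot_even[OF assms(1) s P])
      then show "A \<in> ?E" using A sub by auto
    qed
    then have "card \<C> \<le> card ?E"
      using assms(1) by (intro card_mono) (simp_all add: finite_imp_finite_nsets)
    then show ?thesis using E by linarith
  qed
  have sub: "\<forall>A\<in>\<A>. A \<subseteq> W" using assms(4) by (auto simp: nsets_def)
  have "?R A \<or> ?R B" if AB: "A \<in> \<A>" "B \<in> \<B>" for A B
  proof -
    have "\<forall>A\<in>\<A>. 2 \<le> card (A \<inter> B)" using assms(7) that by blast
    then obtain s where s: "s \<in> W"
        "card {w\<in>W. w \<le> s} + 2 \<le> card (A \<inter> {w\<in>W. w \<le> s}) + card (B \<inter> {w\<in>W. w \<le> s})"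
      using stable_cross_prefix[OF assms(1,6) sub, of 2 B A] AB by auto
    then have "card {w\<in>W. w \<le> s} + 2 \<le> 2 * card (A \<inter> {w\<in>W. w \<le> s}) \<or>
      card {w\<in>W. w \<le> s} + 2 \<le> 2 * card (B \<inter> {w\<in>W. w \<le> s})" by linarith
    then show ?thesis using s(1) by blast
  qed
  \<comment> \<open>If some \<open>A\<close> fails the density condition, every \<open>B\<close>
    satisfies it; so one whole family consists of dense sets.\<close>
  then have "(\<forall>A\<in>\<A>. ?R A) \<or> (\<forall>B\<in>\<B>. ?R B)" by blast
  then show ?thesis using le[OF assms(4)] le[OF assms(5)] by blast
qed

text \<open>Level \<open>j = 1\<close> means containing the first two elements of \<open>W\<close>.
  All other members fall into levels from 2 on, where \<open>ballot_bound\<close> starts with the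
  factor \<open>4 choose 3 = 4\<close>; times 9/8 this is 9/2.\<close>

lemma stable_2_intersecting_heavy_pair:
  fixes W :: "nat set"
  assumes "finite W" "36 * K \<le> card W" "3 \<le> K" "\<G> \<subseteq> nsets W K" "stable W \<G>"
    and "\<forall>A\<in>\<G>. \<forall>B\<in>\<G>. 2 \<le> card (A \<inter> B)"
  shows "\<exists>x\<in>W. \<exists>y\<in>W. x \<noteq> y \<and> 2 * card {A \<in> \<G>. \<not> {x, y} \<subseteq> A} \<le> 9 * ((card W - 3) choose (K - 3))"
proof -
  have "\<forall>q. \<exists>P. q \<le> card W \<longrightarrow> prefix_of W P \<and> card P = q"
    using prefix_of_exists[OF assms(1)] by blast
  then obtain P where P: "\<And>q. q \<le> card W \<Longrightarrow> prefix_of W (P q) \<and> card (P q) = q" by metis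
  have "2 \<le> card W" using assms(2,3) by simp
  then have P2: "P 2 \<subseteq> W" "card (P 2) = 2" using P[of 2] by (auto simp: prefix_of_def)
  then obtain x y where xy: "P 2 = {x, y}" "x \<noteq> y" by (meson card_2_iff)
  let ?E = "{A \<in> nsets W K. \<exists>j\<ge>2. 2 * j \<le> card W \<and> Suc j \<le> card (A \<inter> P (2 * j))}"
  have "8 * card ?E \<le> 9 * ballot_bound (card W) K 2"
    using assms P by (intro card_ballot_le) auto
  moreover have "ballot_bound (card W) K 2 = 4 * ((card W - 3) choose (K - 3))"
    by (simp add: ballot_bound_def numeral_2_eq_2 numeral_3_eq_3)
  ultimately have E: "2 * card ?E \<le> 9 * ((card W - 3) choose (K - 3))" by simp
  have sub: "\<forall>A\<in>\<G>. A \<subseteq> W" using assms(4) by (auto simp: nsets_def)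
  have "{A \<in> \<G>. \<not> {x, y} \<subseteq> A} \<subseteq> ?E"
  proof
    fix A assume A: "A \<in> {A \<in> \<G>. \<not> {x, y} \<subseteq> A}"
    then obtain s where s: "s \<in> W"
        "card {w\<in>W. w \<le> s} + 2 \<le> 2 * card (A \<inter> {w\<in>W. w \<le> s})"
      using stable_cross_prefix[OF assms(1,5) sub, of 2 A A] assms(6) by auto
    then obtain j where j: "j \<ge> 1" "2 * j \<le> card W" "Suc j \<le> card (A \<inter> P (2 * j))"
      using ballot_even[OF assms(1) s P] by blast
    have "j \<noteq> 1"
    proof
      assume "j = 1"
      then have "2 \<le> card (A \<inter> {x, y})" using j xy by (simp add: numeral_2_eq_2)
      moreover have "card {x, y} = 2" using xy by simp
      ultimately have "A \<inter> {x, y} = {x, y}" by (intro card_seteq) auto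
      then show False using A by auto
    qed
    then have "j \<ge> 2" using j by simp
    then show "A \<in> ?E" using j A assms(4) by auto
  qed
  then have "card {A \<in> \<G>. \<not> {x, y} \<subseteq> A} \<le> card ?E"
    using assms(1) by (intro card_mono) (simp_all add: finite_imp_finite_nsets)
  then show ?thesis using E xy P2 by (intro bexI[of _ x] bexI[of _ y]) auto
qed

section \<open>Large cross-intersecting families\<close>

lemma trace_card_mono:
  assumes "finite \<F>" "\<And>A. A \<in> \<F> \<Longrightarrow> A \<inter> T = S \<Longrightarrow> A \<inter> T' = S'"
  shows "trace_card \<F> T S \<le> trace_card \<F> T' S'"
  unfolding trace_card_def using assms by (intro card_mono) auto

lemma trace_card_link_avoid:
  assumes "c \<notin> T" "S \<subseteq> T"
  shows "trace_card (link \<F> T S) {c} {} = trace_card \<F> (insert c T) S"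
proof -
  have "inj_on (\<lambda>A. A - T) {A \<in> \<F>. A \<inter> T = S}"
    by (rule inj_onI) (metis (mono_tags, lifting) Int_Diff_Un inf_commute mem_Collect_eq)
  then have inj: "inj_on (\<lambda>A. A - T) {A \<in> \<F>. A \<inter> T = S \<and> c \<notin> A}"
    by (rule inj_on_subset) auto
  have eq: "{B \<in> link \<F> T S. B \<inter> {c} = {}} = (\<lambda>A. A - T) ` {A \<in> \<F>. A \<inter> T = S \<and> c \<notin> A}"
    using assms by (auto simp: link_def)
  have "A \<inter> T = S \<and> c \<notin> A \<longleftrightarrow> A \<inter> insert c T = S" for A
    using assms by auto
  then show ?thesis
    unfolding trace_card_def eq card_image[OF inj] by simp
qed

lemma stable_avoid:
  assumes "stable W \<F>" "V \<subseteq> W" "w \<notin> V"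
  shows "stable V {A \<in> \<F>. w \<notin> A}"
  unfolding stable_def
proof (intro ballI impI)
  fix A i j assume "A \<in> {A \<in> \<F>. w \<notin> A}" "i \<in> V" "j \<in> V" "i < j" "j \<in> A" "i \<notin> A"
  then show "move i j A \<in> {A \<in> \<F>. w \<notin> A}"
    using assms unfolding stable_def by (auto simp: move_def)
qed

lemma stable_avoid_min_2_intersecting:
  assumes "stable W \<A>" "cross_intersecting \<A> \<B>" "w \<in> W" "\<And>v. v \<in> W \<Longrightarrow> v \<noteq> w \<Longrightarrow> w < v"
    and "A \<in> \<A>" "B \<in> \<B>" "A \<subseteq> W" "finite A" "w \<notin> A" "w \<notin> B"
  shows "2 \<le> card (A \<inter> B)"
proof (rule ccontr)
  assume less: "\<not> ?thesis"
  have "A \<inter> B \<noteq> {}" using assms(2,5,6) by (auto simp: cross_intersecting_def)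
  moreover have "finite (A \<inter> B)" using assms by simp
  ultimately have "card (A \<inter> B) > 0" by (simp add: card_gt_0_iff)
  then have "card (A \<inter> B) = 1" using less by simp
  then obtain z where z: "A \<inter> B = {z}" by (rule card_1_singletonE)
  then have "z \<in> A" "z \<in> W" "z \<noteq> w" using assms(7,9) by auto
  then have "move w z A \<in> \<A>"
    using assms(1,3-5,9) unfolding stable_def by blast
  then have "move w z A \<inter> B \<noteq> {}" using assms(2,6) by (auto simp: cross_intersecting_def)
  then show False using z assms(10) by (auto simp: move_def)
qed

lemma binomial_step_down:
  assumes "K \<ge> 1" "m \<ge> 1"
  shows "m choose K = ((m - 1) choose K) + ((m - 1) choose (K - 1))"
  using assms by (cases m; cases K) auto

text \<open>Compare members of \<open>\<A>\<close> through \<open>u\<close> with members of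
  \<open>\<B>\<close> avoiding \<open>u\<close>, on \<open>Y - {u}\<close> with
  \<open>r = 2\<close>. Many of the latter bound the former by \<open>(N - 1) choose (K - 1)\<close>
  minus \<open>(N - 3) choose (K - 1)\<close>, which by Pascal is a sum of two coefficients of size
  at most \<open>(N - 2) choose (K - 2)\<close>.\<close>

lemma heavy_element_avoid:
  fixes Y :: "nat set"
  assumes "finite Y" "2 * K < card Y" "2 \<le> K" "\<A> \<subseteq> nsets Y K" "\<B> \<subseteq> nsets Y K"
    and "cross_intersecting \<A> \<B>" "u \<in> Y"
    and "2 * ((card Y - 2) choose (K - 2)) < trace_card \<A> {u} {u}"
  shows "trace_card \<B> {u} {} < (card Y - 2) choose (K - 2)"
proof (rule ccontr)
  define N where "N = card Y"
  assume "\<not> ?thesis"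
  then have ge: "(N - 2) choose (K - 2) \<le> trace_card \<B> {u} {}" by (simp add: N_def)
  have cY: "card (Y - {u}) = N - 1" using assms by (simp add: N_def)
  have N: "2 * K < N" using assms by (simp add: N_def)
  have s2: "(N - 2) choose (K - 2) \<ge> (N - 3) choose (K - 2)"
    using N by (intro binomial_right_mono) auto
  have "card (link \<A> {u} {u}) + ((card (Y - {u}) - 2) choose (K - 1)) \<le> card (Y - {u}) choose (K - 1)"
  proof (rule card_cross_intersecting_le)
    show "link \<A> {u} {u} \<subseteq> nsets (Y - {u}) (K - 1)" 
      using link_nsets[OF assms(4), of "{u}" "{u}"] by simp
    show "link \<B> {u} {} \<subseteq> nsets (Y - {u}) K" 
      using link_nsets[OF assms(5), of "{u}" "{}"] by simp
    show "cross_intersecting (link \<A> {u} {u}) (link \<B> {u} {})"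
      using assms(6) by (intro cross_intersecting_link) auto
    show "(card (Y - {u}) - 2) choose (K - 2) \<le> card (link \<B> {u} {})"
      using ge s2 by (simp add: cY card_link numeral_3_eq_3 numeral_2_eq_2)
    show "K - 1 + K \<le> card (Y - {u})" unfolding cY using N by linarith
  qed (use assms in auto)
  then have "trace_card \<A> {u} {u} + ((N - 3) choose (K - 1)) \<le> (N - 1) choose (K - 1)"
    by (simp add: cY card_link numeral_3_eq_3 numeral_2_eq_2)
  moreover have "(N - 1) choose (K - 1) = ((N - 2) choose (K - 1)) + ((N - 2) choose (K - 2))"
    using binomial_step_down[of "K - 1" "N - 1"] assms(3) N by (simp add: numeral_2_eq_2)
  moreover have "(N - 2) choose (K - 1) = ((N - 3) choose (K - 1)) + ((N - 3) choose (K - 2))"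
    using binomial_step_down[of "K - 1" "N - 2"] assms(3) N by (simp add: numeral_2_eq_2 numeral_3_eq_3)
  ultimately have "trace_card \<A> {u} {u} \<le> 2 * ((N - 2) choose (K - 2))" using s2 by linarith
  then show False using assms(8) by (simp add: N_def)
qed

text \<open>For large cross-intersecting families every degree is either tiny or almost full, so shifting
  cannot make a degree jump over the gap; if all degrees are tiny, then compressed families yield
  a contradiction.\<close>

lemma cross_intersecting_common_element:
  fixes Y :: "nat set"
  assumes fin: "finite Y" and N: "36 * K + 1 \<le> card Y" and K: "2 \<le> K"
    and sub: "\<A> \<subseteq> nsets Y K" "\<B> \<subseteq> nsets Y K" and cross: "cross_intersecting \<A> \<B>"
    and b: "b = (card Y - 2) choose (K - 2)" and large: "6 * b \<le> card \<A>" "6 * b \<le> card \<B>"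
  shows "\<exists>u\<in>Y. trace_card \<A> {u} {} < b \<and> trace_card \<B> {u} {} < b"
proof (rule ccontr)
  assume none: "\<not> ?thesis"
  have deg: "card \<C> = trace_card \<C> {u} {} + trace_card \<C> {u} {u}" if "\<C> \<subseteq> nsets Y K" for \<C> u
    using trace_card_split[of \<C> u "{}" "{}"] finite_nsets_subset[OF fin that] by simp
  have heavy: "trace_card \<D> {u} {} < b" if "\<C> \<subseteq> nsets Y K" "\<D> \<subseteq> nsets Y K" "cross_intersecting \<C> \<D>" "u \<in> Y"
    "2 * b < trace_card \<C> {u} {u}" for \<C> \<D> u
    using heavy_element_avoid[OF fin _ K that(1-4)] N that(5) b by simp
  have both: "trace_card \<C> {u} {} < b \<and> trace_card \<D> {u} {} < b" 
    if "\<C> \<subseteq> nsets Y K" "\<D> \<subseteq> nsets Y K" "cross_intersecting \<C> \<D>" "u \<in> Y"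
    "6 * b \<le> card \<C>" "6 * b \<le> card \<D>" "2 * b < trace_card \<C> {u} {u}" for \<C> \<D> u
  proof -
    have D: "trace_card \<D> {u} {} < b" using heavy that by blast
    then have "2 * b < trace_card \<D> {u} {u}" using deg[OF that(2), of u] that(6) by linarith
    then have "trace_card \<C> {u} {} < b" 
      using heavy[of \<D> \<C> u] that cross_intersecting_commute[of \<C> \<D>] by blast
    then show ?thesis using D by blast
  qed
  define P where "P = (\<lambda>\<C> \<D>. \<C> \<subseteq> nsets Y K \<and> \<D> \<subseteq> nsets Y K \<and> cross_intersecting \<C> \<D> \<and>
    6 * b \<le> card \<C> \<and> 6 * b \<le> card \<D> \<and> (\<forall>u\<in>Y. trace_card \<C> {u} {u} \<le> 2 * b \<and> trace_card \<D> {u} {u} \<le> 2 * b))"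
  \<comment> \<open>By \<open>both\<close>, a degree above \<open>2 * b\<close> would yield a common
    element. So the invariant \<open>P\<close> follows as soon as no common element exists.\<close>
  have PI: "P \<C> \<D>" if "\<C> \<subseteq> nsets Y K" "\<D> \<subseteq> nsets Y K" "cross_intersecting \<C> \<D>"
    "6 * b \<le> card \<C>" "6 * b \<le> card \<D>" and nb: "\<And>u. u \<in> Y \<Longrightarrow> \<not> (trace_card \<C> {u} {} < b \<and> trace_card \<D> {u} {} < b)" for \<C> \<D>
  proof -
    have "trace_card \<C> {u} {u} \<le> 2 * b \<and> trace_card \<D> {u} {u} \<le> 2 * b" if "u \<in> Y" for u
      using both[of \<C> \<D> u] both[of \<D> \<C> u] nb[OF that] that \<open>\<C> \<subseteq> nsets Y K\<close> \<open>\<D> \<subseteq> nsets Y K\<close>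
        \<open>cross_intersecting \<C> \<D>\<close> \<open>6 * b \<le> card \<C>\<close> \<open>6 * b \<le> card \<D>\<close> cross_intersecting_commute[of \<C> \<D>]
      by (meson not_less)
    then show ?thesis using that by (simp add: P_def)
  qed
  have "P \<A> \<B>" using PI sub cross large none by blast
  moreover have "finite \<C> \<and> finite \<D> \<and> (\<forall>A\<in>\<C> \<union> \<D>. finite A)" if "P \<C> \<D>" for \<C> \<D>
    using that finite_nsets_subset[OF fin] by (auto simp: P_def nsets_def)
  moreover have "P (shift i j \<C>) (shift i j \<D>)" if PCD: "P \<C> \<D>" and ij: "i \<in> Y" "j \<in> Y" "i < j" for \<C> \<D> i j
  proof (rule PI)
    have CD: "\<C> \<subseteq> nsets Y K" "\<D> \<subseteq> nsets Y K" "cross_intersecting \<C> \<D>"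
      "6 * b \<le> card \<C>" "6 * b \<le> card \<D>" and le: "\<And>u. u \<in> Y \<Longrightarrow> trace_card \<C> {u} {u} \<le> 2 * b"
      using PCD by (simp_all add: P_def)
    show sub': "shift i j \<C> \<subseteq> nsets Y K" "shift i j \<D> \<subseteq> nsets Y K"
      using shift_nsets[OF CD(1) ij(1)] shift_nsets[OF CD(2) ij(1)] .
    show "cross_intersecting (shift i j \<C>) (shift i j \<D>)"
      using CD(3) ij by (intro cross_intersecting_shift) auto
    show "6 * b \<le> card (shift i j \<C>)" "6 * b \<le> card (shift i j \<D>)"
      using CD by auto
    fix u assume u: "u \<in> Y"
    have finC: "finite \<C>" using finite_nsets_subset[OF fin CD(1)] .
    \<comment> \<open>The worst case is \<open>u = i\<close>, with \<open>2 * b + 2 * b\<close>. At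
      least \<open>6 * b - 4 * b\<close> members then avoid \<open>u\<close>, so \<open>u\<close>
      cannot become a common element.\<close>
    have "trace_card (shift i j \<C>) {u} {u} \<le> 4 * b"
    proof (cases "u = i")
      case True
      have "trace_card (shift i j \<C>) {i} {i} \<le> trace_card \<C> {i} {i} + trace_card \<C> {j} {j}"
        using trace_card_shift_insert_le[OF finC, of i "{}" j] by simp
      then show ?thesis using le[OF ij(1)] le[OF ij(2)] True by simp
    next
      case False
      then have "trace_card (shift i j \<C>) {u} {u} \<le> trace_card \<C> {u} {u}"
        using trace_card_shift_le[OF finC] by auto
      then show ?thesis using le[OF u] by linarith
    qed
    then show "\<not> (trace_card (shift i j \<C>) {u} {} < b \<and> trace_card (shift i j \<D>) {u} {} < b)"
      using deg[OF sub'(1), of u] CD(4) by auto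
  qed
  ultimately obtain \<C> \<D> where CD: "P \<C> \<D>" and st: "stable Y \<C>" "stable Y \<D>"
    using exists_stable_pair[of P \<A> \<B> Y] by blast
  note CD = CD[unfolded P_def]
  define w where "w = Min Y"
  have "Y \<noteq> {}" using N by auto
  then have w: "w \<in> Y" "\<And>v. v \<in> Y \<Longrightarrow> v \<noteq> w \<Longrightarrow> w < v"
    using fin Min_in[of Y] Min_le[of Y] unfolding w_def by fastforce+
  define C0 where "C0 = {A \<in> \<C>. w \<notin> A}"
  define D0 where "D0 = {A \<in> \<D>. w \<notin> A}"
  have sub0: "C0 \<subseteq> nsets (Y - {w}) K" "D0 \<subseteq> nsets (Y - {w}) K"
    using CD by (auto simp: C0_def D0_def nsets_def)
  have cY: "card (Y - {w}) = card Y - 1" using w fin by simp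
  have card0: "4 * b \<le> card C0" "4 * b \<le> card D0"
  proof -
    have "card C0 = trace_card \<C> {w} {}" "card D0 = trace_card \<D> {w} {}"
      by (simp_all add: C0_def D0_def trace_card_def)
    then show "4 * b \<le> card C0" "4 * b \<le> card D0"
      using CD deg[of \<C> w] deg[of \<D> w] w(1) by force+
  qed
  have "\<forall>A\<in>C0. \<forall>B\<in>D0. 2 \<le> card (A \<inter> B)"
  proof (intro ballI)
    fix A B assume "A \<in> C0" "B \<in> D0"
    then show "2 \<le> card (A \<inter> B)"
      using CD by (intro stable_avoid_min_2_intersecting[OF st(1) _ w, of \<D>]) (auto simp: C0_def D0_def nsets_def)
  qed
  moreover have "stable (Y - {w}) C0" unfolding C0_def using st(1) by (rule stable_avoid) auto
  \<comment> \<open>One of the two families would have at most \<open>9/8 * b\<close> members,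
    although both have at least \<open>4 * b\<close>.\<close>
  ultimately have "8 * card C0 \<le> 9 * ((card (Y - {w}) - 2) choose (K - 2)) \<or> 8 * card D0 \<le> 9 * ((card (Y - {w}) - 2) choose (K - 2))"
    using fin N K sub0 by (intro card_stable_cross_2_intersecting_le) (auto simp: cY)
  moreover have "(card (Y - {w}) - 2) choose (K - 2) \<le> b"
    unfolding b cY by (intro binomial_right_mono) auto
  moreover have "b > 0" using N K unfolding b by (intro zero_less_binomial) auto
  ultimately show False using card0 by linarith
qed

section \<open>Families on a large ground set\<close>

text \<open>For \<open>k \<ge> 3\<close> the truncated \<open>k - 3\<close> in \<open>B\<close> is
  the true index; smaller \<open>k\<close> are left to
  \<open>exists_zero_pair_degree\<close>.\<close>

locale large_ground =
  fixes X :: "nat set" and k :: nat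
  assumes finX: "finite X" and k3: "3 \<le> k" and large: "36 * (k + 6) \<le> card X"
begin

definition B :: nat where "B = (card X - 4) choose (k - 3)"

lemma B_pos: "0 < B"
  unfolding B_def using k3 large by (intro zero_less_binomial) auto

lemma binomial_5_le_B: "(card X - 5) choose (k - 3) \<le> B"
  unfolding B_def by (intro binomial_right_mono) auto

lemma binomial_3_less_2B: "(card X - 3) choose (k - 3) < 2 * B"
proof -
  define m where "m = card X - 4"
  have m: "card X = m + 4" using large by (simp add: m_def)
  have "(Suc m - (k - 3)) * (Suc m choose (k - 3)) = Suc m * (m choose (k - 3))"
    using binomial_absorb_comp[of "Suc m" "k - 3"] by simp
  moreover have "Suc m < 2 * (Suc m - (k - 3))" using large m k3 by simp
  moreover have "0 < m choose (k - 3)" using B_pos by (simp add: B_def m)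
  ultimately have "(Suc m - (k - 3)) * (Suc m choose (k - 3)) < (2 * (Suc m - (k - 3))) * (m choose (k - 3))"
    by (metis mult_strict_right_mono)
  then have "(Suc m choose (k - 3)) < 2 * (m choose (k - 3))"
    by (metis mult.assoc mult.commute mult_less_cancel1)
  then show ?thesis by (simp add: B_def m)
qed

section \<open>Light families and the gap for members through a pair\<close>

definition light :: "nat set set \<Rightarrow> bool" where
  "light \<F> \<longleftrightarrow> (\<forall>x\<in>X. \<forall>y\<in>X. x \<noteq> y \<longrightarrow> trace_card \<F> {x, y} {x, y} < 4 * B)"

lemma lightD: "light \<F> \<Longrightarrow> x \<in> X \<Longrightarrow> y \<in> X \<Longrightarrow> x \<noteq> y \<Longrightarrow> trace_card \<F> {x, y} {x, y} < 4 * B"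
  by (simp add: light_def)

context
  fixes \<F> :: "nat set set"
  assumes sub: "\<F> \<subseteq> nsets X k" and int: "intersecting \<F>"
begin

lemma finF: "finite \<F>"
  using finite_nsets_subset[OF finX sub] .

lemma trace_card_split_pair:
  assumes "x \<noteq> y"
  shows "trace_card \<F> {x} {} = trace_card \<F> {x, y} {} + trace_card \<F> {x, y} {y}"
    and "trace_card \<F> {x} {x} = trace_card \<F> {x, y} {x} + trace_card \<F> {x, y} {x, y}"
  using trace_card_split[OF finF, of y "{x}" "{}"] trace_card_split[OF finF, of y "{x}" "{x}"] assms
  by (simp_all add: insert_commute)

lemma card_split: "card \<F> = trace_card \<F> {x} {} + trace_card \<F> {x} {x}"
  using trace_card_split[OF finF, of x "{}" "{}"] by simp

text \<open>Origin of \<open>4 * B\<close>: outside \<open>x, y\<close> there are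
  \<open>N + 3\<close> points, and \<open>r = 3\<close> bounds the members through both by
  \<open>(N + 3) choose (k - 2)\<close> minus \<open>N choose (k - 2)\<close>. Three Pascal steps
  leave coefficients over \<open>k - 3\<close> with upper indices \<open>N + 2\<close>,
  \<open>N + 1\<close> and \<open>N\<close>, bounded by \<open>2 * B\<close>, \<open>B\<close> and
  \<open>B\<close>.\<close>

lemma heavy_pair_avoid:
  assumes "x \<in> X" "y \<in> X" "x \<noteq> y" "4 * B \<le> trace_card \<F> {x, y} {x, y}"
  shows "trace_card \<F> {x, y} {} < (card X - 5) choose (k - 3)"
proof (rule ccontr)
  define N where "N = card X - 5"
  have cX: "card X = N + 5" using large by (simp add: N_def)
  assume "\<not> ?thesis"
  then have ge: "N choose (k - 3) \<le> trace_card \<F> {x, y} {}" by (simp add: N_def)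
  have cY: "card (X - {x, y}) = N + 3" using assms finX cX by (simp add: card_Diff_subset)
  have "card (link \<F> {x, y} {x, y}) + ((card (X - {x, y}) - 3) choose (k - 2)) \<le> card (X - {x, y}) choose (k - 2)"
  proof (rule card_cross_intersecting_le)
    show "link \<F> {x, y} {x, y} \<subseteq> nsets (X - {x, y}) (k - 2)"
      using link_nsets[OF sub, of "{x, y}" "{x, y}"] assms(3) by (simp add: numeral_2_eq_2)
    show "link \<F> {x, y} {} \<subseteq> nsets (X - {x, y}) k"
      using link_nsets[OF sub, of "{x, y}" "{}"] by simp
    show "cross_intersecting (link \<F> {x, y} {x, y}) (link \<F> {x, y} {})"
      using int by (intro cross_intersecting_link) (auto simp: intersecting_iff_cross)
    show "(card (X - {x, y}) - 3) choose (k - 3) \<le> card (link \<F> {x, y} {})"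
      using ge by (simp add: cY card_link)
    show "k - 2 + k \<le> card (X - {x, y})" unfolding cY using large cX k3 by simp
  qed (use finX k3 in auto)
  then have "trace_card \<F> {x, y} {x, y} + (N choose (k - 2)) \<le> (N + 3) choose (k - 2)"
    by (simp add: cY card_link)
  moreover have "(N + 3) choose (k - 2) = ((N + 2) choose (k - 2)) + ((N + 2) choose (k - 3))"
    using binomial_step_down[of "k - 2" "N + 3"] k3 by (simp add: numeral_2_eq_2 numeral_3_eq_3)
  moreover have "(N + 2) choose (k - 2) = ((N + 1) choose (k - 2)) + ((N + 1) choose (k - 3))"
    using binomial_step_down[of "k - 2" "N + 2"] k3 by (simp add: numeral_2_eq_2 numeral_3_eq_3)
  moreover have "(N + 1) choose (k - 2) = (N choose (k - 2)) + (N choose (k - 3))"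
    using binomial_step_down[of "k - 2" "N + 1"] k3 by (simp add: numeral_2_eq_2 numeral_3_eq_3)
  moreover have "(N + 2) choose (k - 3) < 2 * B" "(N + 1) choose (k - 3) = B" "N choose (k - 3) \<le> B"
    using binomial_3_less_2B binomial_5_le_B by (simp_all add: B_def cX)
  ultimately have "trace_card \<F> {x, y} {x, y} < 4 * B" by linarith
  then show False using assms(4) by simp
qed

lemma common_third_element:
  assumes "x \<in> X" "y \<in> X" "x \<noteq> y" "6 * B \<le> trace_card \<F> {x, y} {x}" "6 * B \<le> trace_card \<F> {x, y} {y}"
  shows "\<exists>c\<in>X - {x, y}. trace_card \<F> {c, x, y} {x} < B \<and> trace_card \<F> {c, x, y} {y} < B"
proof -
  let ?Y = "X - {x, y}"
  have cY: "card ?Y = card X - 2" using assms finX by (simp add: card_Diff_subset)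
  have "\<exists>u\<in>?Y. trace_card (link \<F> {x, y} {x}) {u} {} < B \<and> trace_card (link \<F> {x, y} {y}) {u} {} < B"
  proof (rule cross_intersecting_common_element)
    show "link \<F> {x, y} {x} \<subseteq> nsets ?Y (k - 1)" "link \<F> {x, y} {y} \<subseteq> nsets ?Y (k - 1)"
      using link_nsets[OF sub, of "{x, y}"] by force+
    show "cross_intersecting (link \<F> {x, y} {x}) (link \<F> {x, y} {y})"
      using int assms(3) by (intro cross_intersecting_link) (auto simp: intersecting_iff_cross)
    have "k - 1 - 2 = k - 3" "card X - 2 - 2 = card X - 4" by simp_all
    then show "B = (card ?Y - 2) choose (k - 1 - 2)" by (simp only: B_def cY)
    show "36 * (k - 1) + 1 \<le> card ?Y" unfolding cY using large by (cases k) simp_all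
  qed (use finX k3 assms in \<open>auto simp: card_link\<close>)
  then show ?thesis using trace_card_link_avoid[of _ "{x, y}"] by fastforce
qed

text \<open>One heavy pair makes the other two sides of the triangle heavy, so few members avoid any
  side. The bound \<open>g\<close> stays open because \<open>10 * B\<close> yields the gap for
  shifted families and \<open>36 * B\<close> the final triangle.\<close>

lemma heavy_pair_triangle:
  assumes xy: "x \<in> X" "y \<in> X" "x \<noteq> y" and heavy: "4 * B \<le> trace_card \<F> {x, y} {x, y}"
    and g: "7 * B \<le> g" "\<And>v. v \<in> X \<Longrightarrow> g \<le> trace_card \<F> {v} {}"
  shows "\<exists>c\<in>X - {x, y}. trace_card \<F> {x, y} {} < (card X - 5) choose (k - 3) \<and>
    trace_card \<F> {x, c} {} < (card X - 5) choose (k - 3) \<and> trace_card \<F> {y, c} {} < (card X - 5) choose (k - 3) \<and>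
    g \<le> trace_card \<F> {x, y} {x, y} + 2 * B"
proof -
  have a0: "trace_card \<F> {x, y} {} < (card X - 5) choose (k - 3)"
    using heavy_pair_avoid[OF xy heavy] .
  have a0': "trace_card \<F> {x, y} {} < B" using a0 binomial_5_le_B by linarith
  \<comment> \<open>The 7 in \<open>7 * B\<close> is the 6 required by
    \<open>common_third_element\<close> plus 1 for the members avoiding both points.\<close>
  have "g \<le> trace_card \<F> {x, y} {} + trace_card \<F> {x, y} {y}" using g(2)[OF xy(1)] trace_card_split_pair(1)[OF xy(3)] by simp
  then have ay: "6 * B \<le> trace_card \<F> {x, y} {y}" using a0' g(1) by linarith
  have "g \<le> trace_card \<F> {x, y} {} + trace_card \<F> {x, y} {x}" 
    using g(2)[OF xy(2)] trace_card_split_pair(1)[of y x] xy(3) by (simp add: insert_commute)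
  then have ax: "6 * B \<le> trace_card \<F> {x, y} {x}" using a0' g(1) by linarith
  obtain c where c: "c \<in> X" "c \<noteq> x" "c \<noteq> y" "trace_card \<F> {c, x, y} {x} < B" "trace_card \<F> {c, x, y} {y} < B"
    using common_third_element[OF xy ax ay] by blast
  have "trace_card \<F> {x, y} {x} = trace_card \<F> {c, x, y} {x} + trace_card \<F> {c, x, y} {c, x}"
    "trace_card \<F> {x, y} {y} = trace_card \<F> {c, x, y} {y} + trace_card \<F> {c, x, y} {c, y}"
    using trace_card_split[OF finF, of c "{x, y}"] c by simp_all
  then have "4 * B \<le> trace_card \<F> {c, x, y} {c, x}" "4 * B \<le> trace_card \<F> {c, x, y} {c, y}"
    using ax ay c by linarith+
  moreover have "trace_card \<F> {c, x, y} {c, x} \<le> trace_card \<F> {x, c} {x, c}" "trace_card \<F> {c, x, y} {c, y} \<le> trace_card \<F> {y, c} {y, c}"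
    using xy(3) c by (intro trace_card_mono finF; auto)+
  ultimately have "4 * B \<le> trace_card \<F> {x, c} {x, c}" "4 * B \<le> trace_card \<F> {y, c} {y, c}" by linarith+
  then have ac: "trace_card \<F> {x, c} {} < (card X - 5) choose (k - 3)" "trace_card \<F> {y, c} {} < (card X - 5) choose (k - 3)"
    using heavy_pair_avoid[of x c] heavy_pair_avoid[of y c] xy c by auto
  \<comment> \<open>A member avoiding \<open>c\<close> misses \<open>x\<close>, or contains
    \<open>x\<close> and misses \<open>y\<close>, or contains both. The first two kinds avoid a side
    of the triangle and number less than \<open>2 * B\<close> together.\<close>
  have "g \<le> trace_card \<F> {c} {}" using g(2) c by simp
  also have "\<dots> = trace_card \<F> {c, x} {} + (trace_card \<F> {y, c, x} {x} + trace_card \<F> {y, c, x} {y, x})"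
    using trace_card_split_pair(1)[of c x] trace_card_split[OF finF, of y "{c, x}" "{x}"] xy c by simp
  also have "\<dots> \<le> trace_card \<F> {x, c} {} + (trace_card \<F> {y, c} {} + trace_card \<F> {x, y} {x, y})"
  proof -
    have "trace_card \<F> {c, x} {} \<le> trace_card \<F> {x, c} {}" by (simp add: insert_commute)
    moreover have "trace_card \<F> {y, c, x} {x} \<le> trace_card \<F> {y, c} {}"
    proof (rule trace_card_mono[OF finF])
      fix A assume A: "A \<inter> {y, c, x} = {x}"
      have "z = x" if "z \<in> A" "z = y \<or> z = c" for z
      proof -
        have "z \<in> A \<inter> {y, c, x}" using that by blast
        then show ?thesis unfolding A by simp
      qed
      then have "y \<notin> A" "c \<notin> A" using xy(3) c(2) by metis+
      then show "A \<inter> {y, c} = {}" by simp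
    qed
    moreover have "trace_card \<F> {y, c, x} {y, x} \<le> trace_card \<F> {x, y} {x, y}"
    proof (rule trace_card_mono[OF finF])
      fix A assume "A \<inter> {y, c, x} = {y, x}"
      then have "x \<in> A" "y \<in> A" by (metis Int_iff insertI1 insertI2)+
      then show "A \<inter> {x, y} = {x, y}" by simp
    qed
    ultimately show ?thesis by linarith
  qed
  finally have "g \<le> trace_card \<F> {x, y} {x, y} + 2 * B" using ac binomial_5_le_B by linarith
  then show ?thesis using a0 ac c by blast
qed

lemma light_or_very_heavy:
  assumes "\<And>v. v \<in> X \<Longrightarrow> 10 * B \<le> trace_card \<F> {v} {}"
    and "\<And>x y. x \<in> X \<Longrightarrow> y \<in> X \<Longrightarrow> x \<noteq> y \<Longrightarrow> trace_card \<F> {x, y} {x, y} < 8 * B"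
  shows "light \<F>"
  unfolding light_def
proof (intro ballI impI)
  fix x y assume xy: "x \<in> X" "y \<in> X" "x \<noteq> y"
  show "trace_card \<F> {x, y} {x, y} < 4 * B"
  proof (rule ccontr)
    assume "\<not> ?thesis"
    then have "10 * B \<le> trace_card \<F> {x, y} {x, y} + 2 * B"
      using heavy_pair_triangle[OF xy, of "10 * B"] assms(1) by (auto simp: not_less)
    then show False using assms(2)[OF xy] by linarith
  qed
qed

text \<open>If both counts were large, a common third element \<open>c\<close> would put more than
  \<open>5 * B\<close> members through \<open>x\<close> and \<open>c\<close>.\<close>

lemma light_min_degree:
  assumes "light \<F>" "x \<in> X" "y \<in> X" "x \<noteq> y"
  shows "trace_card \<F> {x, y} {x} < 6 * B \<or> trace_card \<F> {x, y} {y} < 6 * B"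
proof (rule ccontr)
  assume "\<not> ?thesis"
  then have ge: "6 * B \<le> trace_card \<F> {x, y} {x}" "6 * B \<le> trace_card \<F> {x, y} {y}" by auto
  obtain c where c: "c \<in> X" "c \<noteq> x" "c \<noteq> y" "trace_card \<F> {c, x, y} {x} < B"
    using common_third_element[OF assms(2-4) ge] by blast
  have "trace_card \<F> {x, y} {x} = trace_card \<F> {c, x, y} {x} + trace_card \<F> {c, x, y} {c, x}"
    using trace_card_split[OF finF, of c "{x, y}"] c by simp
  moreover have "trace_card \<F> {c, x, y} {c, x} \<le> trace_card \<F> {x, c} {x, c}"
    using assms(4) c by (intro trace_card_mono finF) auto
  moreover have "trace_card \<F> {x, c} {x, c} < 4 * B" using lightD[OF assms(1)] assms(2) c by auto
  ultimately show False using ge c by linarith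
qed

text \<open>At least \<open>10 * B - 4 * B\<close> members contain \<open>x\<close> but not
  \<open>y\<close>, so by \<open>light_min_degree\<close> fewer than \<open>6 * B\<close> contain
  \<open>y\<close> but not \<open>x\<close>; adding the pair stays below \<open>10 * B\<close>.
  Hence at most one point has degree \<open>10 * B\<close> or more.\<close>

lemma light_big_degree:
  assumes "light \<F>" "x \<in> X" "10 * B \<le> trace_card \<F> {x} {x}" "y \<in> X" "x \<noteq> y"
  shows "trace_card \<F> {x, y} {y} < 6 * B" "trace_card \<F> {y} {y} < 10 * B"
proof -
  have l: "trace_card \<F> {x, y} {x, y} < 4 * B" using lightD assms by blast
  then have "\<not> trace_card \<F> {x, y} {x} < 6 * B"
    using assms(3) trace_card_split_pair(2)[OF assms(5)] by linarith
  then show 1: "trace_card \<F> {x, y} {y} < 6 * B" using light_min_degree[OF assms(1,2,4,5)] by blast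
  have "trace_card \<F> {y} {y} = trace_card \<F> {x, y} {y} + trace_card \<F> {x, y} {x, y}"
    using trace_card_split_pair(2)[of y x] assms(5) by (simp add: insert_commute)
  then show "trace_card \<F> {y} {y} < 10 * B" using 1 l by linarith
qed

section \<open>Light families under shifting and compression\<close>

lemma light_shift_pairs:
  assumes "light \<F>" "i \<in> X" "j \<in> X" "i \<noteq> j" "x \<in> X" "y \<in> X" "x \<noteq> y"
  shows "trace_card (shift i j \<F>) {x, y} {x, y} < 8 * B"
proof -
  have *: "trace_card (shift i j \<F>) {i, z} {i, z} < 8 * B" if "z \<in> X" "z \<noteq> i" for z
  proof (cases "z = j")
    case True
    then have "trace_card (shift i j \<F>) {i, z} {i, z} \<le> trace_card \<F> {i, z} {i, z}"
      using finF by (intro trace_card_shift_le) auto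
    moreover have "trace_card \<F> {i, z} {i, z} < 4 * B" using lightD[OF assms(1,2) that(1)] that(2) by simp
    ultimately show ?thesis by linarith
  next
    case False
    have "trace_card (shift i j \<F>) {i, z} {i, z} \<le> trace_card \<F> {i, z} {i, z} + trace_card \<F> {j, z} {j, z}"
      using trace_card_shift_insert_le[OF finF, of i "{z}" j] that False by simp
    moreover have "trace_card \<F> {i, z} {i, z} < 4 * B" "trace_card \<F> {j, z} {j, z} < 4 * B"
      using lightD[OF assms(1)] assms(2,3) that False by auto
    ultimately show ?thesis by linarith
  qed
  show ?thesis
  proof (cases "i \<in> {x, y}")
    case True
    then show ?thesis using *[of x] *[of y] assms by (auto simp: insert_commute)
  next
    case False
    then have "trace_card (shift i j \<F>) {x, y} {x, y} \<le> trace_card \<F> {x, y} {x, y}"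
      using finF by (intro trace_card_shift_le) auto
    moreover have "trace_card \<F> {x, y} {x, y} < 4 * B" using lightD assms by blast
    ultimately show ?thesis by linarith
  qed
qed

lemma shift_degree_le:
  assumes "i \<noteq> j"
  shows "trace_card (shift i j \<F>) {y} {y} \<le> (if y = i then trace_card \<F> {i} {i} + trace_card \<F> {j} {j} else trace_card \<F> {y} {y})"
  using trace_card_shift_insert_le[OF finF, of i "{}" j] trace_card_shift_le[OF finF, of i "{y}" j] assms by auto

lemma shift_sub_int:
  assumes "i \<in> X" "i \<noteq> j"
  shows "shift i j \<F> \<subseteq> nsets X k" "intersecting (shift i j \<F>)"
  using shift_nsets[OF sub assms(1)] cross_intersecting_shift[of \<F> \<F> i j] int assms(2)
  by (simp_all add: intersecting_iff_cross)

text \<open>Excluding \<open>x\<close> leaves a family compressed on the other points; excluding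
  their minimum \<open>w\<close> as well makes it 2-intersecting. Of its at least
  \<open>10 * B\<close> members at most \<open>9/2 * B\<close> miss the heavy pair, so more than
  \<open>4 * B\<close> contain it.\<close>

lemma stable_not_light:
  assumes "x \<in> X" "stable (X - {x}) \<F>" "\<And>w. w \<in> X \<Longrightarrow> w \<noteq> x \<Longrightarrow> 10 * B \<le> trace_card \<F> {x, w} {}"
  shows "\<not> light \<F>"
proof -
  define W where "W = X - {x}"
  define w where "w = Min W"
  have cW: "card W = card X - 1" using assms finX by (simp add: W_def)
  then have "card W \<noteq> 0" using large by simp
  then have "W \<noteq> {}" "finite W" by (auto intro: card_ge_0_finite)
  then have w: "w \<in> W" "\<And>v. v \<in> W \<Longrightarrow> v \<noteq> w \<Longrightarrow> w < v"
    using Min_in[of W] Min_le[of W] unfolding w_def by fastforce+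
  define G where "G = {A \<in> \<F>. x \<notin> A}"
  define G0 where "G0 = {A \<in> G. w \<notin> A}"
  have GW: "stable W G" "cross_intersecting G G"
    using stable_avoid[OF assms(2), of W x] int 
    by (auto simp: G_def W_def intersecting_iff_cross cross_intersecting_def)
  have G0: "stable (W - {w}) G0" "G0 \<subseteq> nsets (W - {w}) k"
    using stable_avoid[OF GW(1), of "W - {w}" w] sub by (auto simp: G0_def G_def W_def nsets_def)
  have two: "\<forall>A\<in>G0. \<forall>B\<in>G0. 2 \<le> card (A \<inter> B)"
  proof (intro ballI)
    fix A B assume "A \<in> G0" "B \<in> G0"
    then show "2 \<le> card (A \<inter> B)"
      using G0(2) by (intro stable_avoid_min_2_intersecting[OF GW w]) (auto simp: G0_def nsets_def)
  qed
  have cW': "card (W - {w}) = card X - 2" using w cW by simp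
  have "\<exists>y\<in>W - {w}. \<exists>z\<in>W - {w}. y \<noteq> z \<and>
    2 * card {A \<in> G0. \<not> {y, z} \<subseteq> A} \<le> 9 * ((card (W - {w}) - 3) choose (k - 3))"
    using \<open>finite W\<close> large k3 G0 two
    by (intro stable_2_intersecting_heavy_pair) (auto simp: cW')
  then obtain y z where "y \<in> W - {w}" "z \<in> W - {w}" and yz: "y \<noteq> z"
    and le': "2 * card {A \<in> G0. \<not> {y, z} \<subseteq> A} \<le> 9 * ((card (W - {w}) - 3) choose (k - 3))"
    by blast
  then have yz: "y \<in> X" "z \<in> X" "y \<noteq> z" by (simp_all add: W_def)
  have "card X - 2 - 3 = card X - 5" by simp
  then have le: "2 * card {A \<in> G0. \<not> {y, z} \<subseteq> A} \<le> 9 * ((card X - 5) choose (k - 3))"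
    using le' by (simp only: cW')
  have finG0: "finite G0" using finF by (simp add: G0_def G_def)
  have "card G0 = trace_card \<F> {x, w} {}"
    unfolding trace_card_def G0_def G_def by (rule arg_cong[where f = card]) auto
  then have "10 * B \<le> card G0" using assms(3)[of w] w(1) by (simp add: W_def)
  moreover have "card G0 \<le> card {A \<in> G0. \<not> {y, z} \<subseteq> A} + card {A \<in> G0. {y, z} \<subseteq> A}"
  proof -
    have "G0 = {A \<in> G0. \<not> {y, z} \<subseteq> A} \<union> {A \<in> G0. {y, z} \<subseteq> A}" by auto
    then show ?thesis by (metis (no_types, lifting) card_Un_le)
  qed
  moreover have "card {A \<in> G0. {y, z} \<subseteq> A} \<le> trace_card \<F> {y, z} {y, z}"
    unfolding trace_card_self using finF by (intro card_mono) (auto simp: G0_def G_def)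
  ultimately have "4 * B \<le> trace_card \<F> {y, z} {y, z}" using le binomial_5_le_B by linarith
  then show ?thesis using yz lightD by (meson not_less)
qed

end

text \<open>Compress while keeping \<open>x\<close> fixed. One shift at most doubles a pair degree, which cannot bridge the
  gap between \<open>4 B\<close> and \<open>8 B\<close> of \<open>light_or_very_heavy\<close>; hence lightness survives.\<close>

lemma no_light_with_big_degree:
  assumes "\<F> \<subseteq> nsets X k" "intersecting \<F>" "light \<F>" "x \<in> X" "10 * B \<le> trace_card \<F> {x} {x}"
    "16 * B \<le> trace_card \<F> {x} {}" "30 * B \<le> card \<F>"
  shows False
proof -
  define P where "P = (\<lambda>\<F>. \<F> \<subseteq> nsets X k \<and> intersecting \<F> \<and> light \<F> \<and>
    10 * B \<le> trace_card \<F> {x} {x} \<and> 16 * B \<le> trace_card \<F> {x} {} \<and> 30 * B \<le> card \<F>)"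
  have "P \<F>" using assms by (simp add: P_def)
  moreover have "finite \<F> \<and> (\<forall>A\<in>\<F>. finite A)" if "P \<F>" for \<F>
    using that finite_nsets_subset[OF finX] by (auto simp: P_def nsets_def)
  moreover have "P (shift i j \<F>)" if PF: "P \<F>" and ij: "i \<in> X - {x}" "j \<in> X - {x}" "i < j" for \<F> i j
  proof -
    let ?G = "shift i j \<F>"
    have F: "\<F> \<subseteq> nsets X k" "intersecting \<F>" and l: "light \<F>"
      and dx: "10 * B \<le> trace_card \<F> {x} {x}" "16 * B \<le> trace_card \<F> {x} {}" "30 * B \<le> card \<F>"
      using PF by (simp_all add: P_def)
    have ij': "i \<in> X" "j \<in> X" "i \<noteq> j" "x \<noteq> i" "x \<noteq> j" using ij by auto
    have G: "?G \<subseteq> nsets X k" "intersecting ?G"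
      using shift_sub_int[OF F ij'(1,3)] .
    have eq: "trace_card ?G {x} S = trace_card \<F> {x} S" for S
      using ij' by (intro trace_card_shift_outside) auto
    have "10 * B \<le> trace_card ?G {v} {}" if v: "v \<in> X" for v
    proof (cases "v = x")
      case True
      then show ?thesis using dx eq by simp
    next
      case False
      \<comment> \<open>Only \<open>x\<close> may have degree \<open>10 * B\<close>. A shift among
        other points adds at most two smaller degrees, so at least \<open>30 * B - 20 * B\<close>
        members avoid \<open>v\<close> afterwards.\<close>
      have small: "trace_card \<F> {u} {u} < 10 * B" if "u \<in> X" "u \<noteq> x" for u
        using light_big_degree(2)[OF F l assms(4) dx(1)] that by metis
      have "trace_card ?G {v} {v} \<le> 20 * B"
        using shift_degree_le[OF F ij'(3), of v] small[of v] small[of i] small[of j] ij' v False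
        by (auto split: if_splits)
      then show ?thesis using card_split[OF G, of v] dx(3) by simp
    qed
    then have "light ?G"
      using light_or_very_heavy[OF G] light_shift_pairs[OF F l ij'(1-3)] by blast
    then show ?thesis using G dx eq by (simp add: P_def)
  qed
  ultimately obtain \<G> where "P \<G>" and st: "stable (X - {x}) \<G>"
    using exists_stable[of P \<F> "X - {x}"] by blast
  then have G: "\<G> \<subseteq> nsets X k" "intersecting \<G>" and l: "light \<G>"
      and dx: "10 * B \<le> trace_card \<G> {x} {x}" "16 * B \<le> trace_card \<G> {x} {}"
      by (simp_all add: P_def)
  have "10 * B \<le> trace_card \<G> {x, w} {}" if "w \<in> X" "w \<noteq> x" for w
    using light_big_degree(1)[OF G l assms(4) dx(1) that(1)] trace_card_split_pair(1)[OF G, of x w] that(2) dx(2)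
    by simp
  then show False using stable_not_light[OF G assms(4) st] l by blast
qed

text \<open>Small degrees persist: a shift creating a degree of \<open>10 * B\<close> would produce
  a family excluded by \<open>no_light_with_big_degree\<close>, since
  \<open>36 * B - 20 * B = 16 * B\<close> members still avoid every point. So compression over all
  of \<open>X\<close> is possible.\<close>

lemma no_light_with_small_degrees:
  assumes "\<F> \<subseteq> nsets X k" "intersecting \<F>" "light \<F>" "36 * B \<le> card \<F>"
    "\<And>v. v \<in> X \<Longrightarrow> trace_card \<F> {v} {v} < 10 * B"
  shows False
proof -
  define P where "P = (\<lambda>\<F>. \<F> \<subseteq> nsets X k \<and> intersecting \<F> \<and> light \<F> \<and>
    36 * B \<le> card \<F> \<and> (\<forall>v\<in>X. trace_card \<F> {v} {v} < 10 * B))"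
  have "P \<F>" using assms by (simp add: P_def)
  moreover have "finite \<F> \<and> (\<forall>A\<in>\<F>. finite A)" if "P \<F>" for \<F>
    using that finite_nsets_subset[OF finX] by (auto simp: P_def nsets_def)
  moreover have "P (shift i j \<F>)" if PF: "P \<F>" and ij: "i \<in> X" "j \<in> X" "i < j" for \<F> i j
  proof -
    let ?G = "shift i j \<F>"
    have F: "\<F> \<subseteq> nsets X k" "intersecting \<F>" and l: "light \<F>"
      and c: "36 * B \<le> card \<F>" and small: "\<And>v. v \<in> X \<Longrightarrow> trace_card \<F> {v} {v} < 10 * B"
      using PF by (simp_all add: P_def)
    have ij': "i \<noteq> j" using ij by auto
    have G: "?G \<subseteq> nsets X k" "intersecting ?G"
      using shift_sub_int[OF F ij(1) ij'] .
    have deg: "trace_card ?G {v} {v} \<le> 20 * B" if v: "v \<in> X" for v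
      using shift_degree_le[OF F ij', of v] small[OF v] small[OF ij(1)] small[OF ij(2)]
      by (auto split: if_splits)
    have avoid: "16 * B \<le> trace_card ?G {v} {}" if v: "v \<in> X" for v
      using deg[OF v] card_split[OF G, of v] c by simp
    have lG: "light ?G"
    proof (rule light_or_very_heavy[OF G])
      show "10 * B \<le> trace_card ?G {v} {}" if "v \<in> X" for v using avoid[OF that] by linarith
    qed (rule light_shift_pairs[OF F l ij(1,2) ij'])
    have "trace_card ?G {v} {v} < 10 * B" if v: "v \<in> X" for v
    proof (rule ccontr)
      assume "\<not> ?thesis"
      moreover have "30 * B \<le> card ?G" using c by simp
      ultimately show False using no_light_with_big_degree[OF G lG v _ avoid[OF v]] by linarith
    qed
    then show ?thesis using G lG c by (simp add: P_def)
  qed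
  ultimately obtain \<G> where "P \<G>" and st: "stable X \<G>"
    using exists_stable[of P \<F> X] by blast
  then have G: "\<G> \<subseteq> nsets X k" "intersecting \<G>" and l: "light \<G>"
      and c: "36 * B \<le> card \<G>" and small: "\<And>v. v \<in> X \<Longrightarrow> trace_card \<G> {v} {v} < 10 * B"
      by (simp_all add: P_def)
  have "card X \<noteq> 0" using large by simp
  then have "X \<noteq> {}" by auto
  then obtain x where x: "x \<in> X" by blast
  have "stable (X - {x}) \<G>" using st by (simp add: stable_def)
  moreover have "10 * B \<le> trace_card \<G> {x, w} {}" if "w \<in> X" "w \<noteq> x" for w
  proof -
    have "trace_card \<G> {x, w} {w} \<le> trace_card \<G> {w} {w}"
      using that by (intro trace_card_mono finF[OF G]) auto
    then show ?thesis
      using trace_card_split_pair(1)[OF G, of x w] that card_split[OF G, of x] small[OF x] small[OF that(1)] c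
      by simp
  qed
  ultimately show False using stable_not_light[OF G x] l by blast
qed

lemma exists_triangle:
  assumes F: "\<F> \<subseteq> nsets X k" "intersecting \<F>" and g: "\<And>v. v \<in> X \<Longrightarrow> 36 * B \<le> trace_card \<F> {v} {}"
  shows "\<exists>x\<in>X. \<exists>y\<in>X. \<exists>c\<in>X. x \<noteq> y \<and> x \<noteq> c \<and> y \<noteq> c \<and>
    trace_card \<F> {x, y} {} < (card X - 5) choose (k - 3) \<and>
    trace_card \<F> {x, c} {} < (card X - 5) choose (k - 3) \<and> trace_card \<F> {y, c} {} < (card X - 5) choose (k - 3)"
proof -
  have "card X \<noteq> 0" using large by simp
  then have "X \<noteq> {}" by auto
  then have c: "36 * B \<le> card \<F>" using g card_split[OF F] by (metis ex_in_conv trans_le_add1)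
  have "\<not> light \<F>"
  proof
    assume l: "light \<F>"
    have "trace_card \<F> {v} {v} < 10 * B" if v: "v \<in> X" for v
    proof (rule ccontr)
      assume "\<not> ?thesis"
      moreover have "16 * B \<le> trace_card \<F> {v} {}" "30 * B \<le> card \<F>" using g[OF v] c by linarith+
      ultimately show False using no_light_with_big_degree[OF F l v] by auto
    qed
    then show False using no_light_with_small_degrees[OF F l c] by blast
  qed
  then obtain x y where xy: "x \<in> X" "y \<in> X" "x \<noteq> y" "4 * B \<le> trace_card \<F> {x, y} {x, y}"
    by (auto simp: light_def not_less)
  obtain c where "c \<in> X - {x, y}" "trace_card \<F> {x, y} {} < (card X - 5) choose (k - 3)"
    "trace_card \<F> {x, c} {} < (card X - 5) choose (k - 3)" "trace_card \<F> {y, c} {} < (card X - 5) choose (k - 3)"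
    using heavy_pair_triangle[OF F xy, of "36 * B"] g by auto
  then show ?thesis using xy by (intro bexI[of _ x] bexI[of _ y] bexI[of _ c]) auto
qed

end

section \<open>The triangle and the final count\<close>

text \<open>With \<open>d = M - j\<close> the quotient is
  \<open>d * (d + 1) / ((j + 1) * (M + 1))\<close>. Since \<open>d \<ge> 16 * (j + 1)\<close> and
  \<open>M + 1 \<le> 2 * (d + 1)\<close>, it is at least 16/2.\<close>

lemma binomial_ratio_ge_8:
  assumes "20 * Suc j \<le> M"
  shows "8 * (Suc M choose j) \<le> M choose Suc j"
proof -
  define d where "d = M - j"
  have d: "M = j + d" using assms by (simp add: d_def)
  have d20: "20 * Suc j \<le> j + d" using assms d by simp
  have 1: "Suc j * (M choose Suc j) = d * (M choose j)"
    using binomial_absorb_comp[of M j] binomial_absorption[of j "M - 1"] d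
    by (metis add_diff_cancel_left' binomial_absorption mult.commute Suc_times_binomial_eq)
  have 2: "Suc d * (Suc M choose j) = Suc M * (M choose j)"
    using binomial_absorb_comp[of "Suc M" j] d by simp
  have le: "8 * (Suc j * Suc M) \<le> Suc d * d"
  proof -
    have "Suc M \<le> 2 * Suc d" "16 * Suc j \<le> d" using d20 d by simp_all
    then have "(16 * Suc j) * Suc M \<le> d * (2 * Suc d)" by (rule mult_le_mono[rotated])
    then show ?thesis by (simp add: algebra_simps)
  qed
  have "(Suc j * Suc d) * (8 * (Suc M choose j)) = (8 * (Suc j * Suc M)) * (M choose j)"
    using 2 by (metis (no_types, lifting) mult.assoc mult.left_commute)
  also have "\<dots> \<le> (Suc d * d) * (M choose j)" using le by (rule mult_le_mono1)
  also have "\<dots> = (Suc j * Suc d) * (M choose Suc j)"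
    using 1 by (metis (no_types, lifting) mult.assoc mult.left_commute)
  finally show ?thesis by (simp only: mult_le_cancel1) simp
qed

text \<open>For the least \<open>r\<close> such that \<open>\<E>\<close> is as large as the star
  through \<open>r\<close> points, \<open>\<A>\<close> loses at least
  \<open>(N - r) choose (k - 2)\<close> sets. Smallness forces \<open>r \<ge> 3\<close>, and
  minimality keeps \<open>card \<E>\<close> within \<open>Suc (N - r) choose (k - 3)\<close>, at
  most an eighth of that loss.\<close>

lemma small_family_deficiency:
  fixes Y :: "nat set"
  assumes fin: "finite Y" and k: "3 \<le> k" "36 * k \<le> card Y" and l: "l = k - 1 \<or> l = k"
    and sub: "\<A> \<subseteq> nsets Y (k - 2)" "\<E> \<subseteq> nsets Y l" and cross: "cross_intersecting \<A> \<E>"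
    and small: "card \<E> < (card Y - 2) choose (k - 3)"
  shows "8 * card \<E> + card \<A> \<le> card Y choose (k - 2)"
proof (cases "\<E> = {}")
  case True
  have "card \<A> \<le> card (nsets Y (k - 2))"
    using sub(1) fin by (intro card_mono) (simp_all add: finite_imp_finite_nsets)
  then show ?thesis using True by (simp add: card_nsets)
next
  case False
  define N where "N = card Y"
  have N: "36 * k \<le> N" using k by (simp add: N_def)
  have fE: "finite \<E>" using finite_nsets_subset[OF fin sub(2)] .
  define Q where "Q = (\<lambda>r. r \<le> l \<and> (N - r) choose (l - r) \<le> card \<E>)"
  have "Q l" using False fE by (simp add: Q_def Suc_le_eq card_gt_0_iff)
  define r where "r = (LEAST r. Q r)"
  have Qr: "r \<le> l" "(N - r) choose (l - r) \<le> card \<E>"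
    using LeastI[of Q, OF \<open>Q l\<close>] by (auto simp: Q_def r_def)
  have least: "\<not> Q s" if "s < r" for s
    using that not_less_Least unfolding r_def by blast
  have sm: "card \<E> < (N - 2) choose (k - 3)" using small by (simp add: N_def)
  have l2: "2 \<le> l" "l \<le> k" "k - 3 \<le> l - 2" using l k by auto
  have "3 \<le> r"
  proof (rule ccontr)
    assume "\<not> 3 \<le> r"
    then have r2: "r \<le> 2" by simp
    have "(N - 2) choose (k - 3) \<le> (N - 2) choose (l - 2)"
      using l2 N by (intro binomial_mono) auto
    also have "\<dots> \<le> (N - r) choose (l - r)"
    proof -
      have step: "a choose b \<le> Suc a choose Suc b" for a b by simp
      have "N - 1 = Suc (N - 2)" "l - 1 = Suc (l - 2)" "N = Suc (N - 1)" "l = Suc (l - 1)"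
        using l2 N k by auto
      then have "(N - 2) choose (l - 2) \<le> (N - 1) choose (l - 1)" "(N - 1) choose (l - 1) \<le> N choose l"
        using step by metis+
      moreover have "r = 0 \<or> r = 1 \<or> r = 2" using r2 by auto
      ultimately show ?thesis by auto
    qed
    finally show False using Qr(2) sm by simp
  qed
  have nQ: "card \<E> < (N - (r - 1)) choose (l - (r - 1))"
    using least[of "r - 1"] \<open>3 \<le> r\<close> Qr(1) by (auto simp: Q_def not_le)
  have eq: "N - (r - 1) = Suc (N - r)" "l - (r - 1) = Suc (l - r)" 
    using \<open>3 \<le> r\<close> Qr(1) l2 N by auto
  have "card \<E> \<le> Suc (N - r) choose (k - 3)"
  proof (cases "Suc (l - r) \<le> k - 3")
    case True
    have "Suc (N - r) choose Suc (l - r) \<le> Suc (N - r) choose (k - 3)"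
      using True N Qr(1) l2 by (intro binomial_mono) auto
    then show ?thesis using nQ unfolding eq by simp
  next
    case False
    \<comment> \<open>Minimality is too weak only for \<open>l = k\<close> and \<open>r = 3\<close>;
      there the hypothesis \<open>small\<close> gives the required bound directly.\<close>
    then have "r = 3" using l2 \<open>3 \<le> r\<close> Qr(1) by linarith
    then have "Suc (N - r) = N - 2" using N k by simp
    then show ?thesis using sm by simp
  qed
  then have "8 * card \<E> \<le> 8 * (Suc (N - r) choose (k - 3))" by simp
  also have "\<dots> \<le> (N - r) choose Suc (k - 3)"
    using N Qr(1) l2 k by (intro binomial_ratio_ge_8) auto
  also have "Suc (k - 3) = k - 2" using k by simp
  finally have "8 * card \<E> \<le> (N - r) choose (k - 2)" .
  moreover have "card \<A> + ((card Y - r) choose (k - 2)) \<le> card Y choose (k - 2)"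
    using Qr N l2 unfolding N_def
    by (intro card_cross_intersecting_le[OF fin sub cross]) auto
  ultimately show ?thesis by (simp add: N_def)
qed

section \<open>Double counting pair degrees by traces\<close>

lemma sum_tr_members:
  assumes "finite X" "\<F> \<subseteq> nsets X k" "finite T"
  shows "(\<Sum>i\<in>X - T. trace_card {A \<in> \<F>. i \<in> A} T S) = (k - card S) * trace_card \<F> T S"
proof -
  let ?G = "{A \<in> \<F>. A \<inter> T = S}"
  have finG: "finite ?G" using finite_nsets_subset[OF assms(1,2)] by simp
  have "(\<Sum>i\<in>X - T. trace_card {A \<in> \<F>. i \<in> A} T S) = (\<Sum>i\<in>X - T. \<Sum>A\<in>{A \<in> ?G. i \<in> A}. 1)"
    unfolding trace_card_def by (intro sum.cong refl) (simp, rule arg_cong[where f = card], auto)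
  also have "\<dots> = (\<Sum>A\<in>?G. \<Sum>i\<in>{i \<in> X - T. i \<in> A}. 1)"
    using assms(1) finG by (intro sum.swap_restrict) auto
  also have "\<dots> = (\<Sum>A\<in>?G. k - card S)"
  proof (rule sum.cong[OF refl])
    fix A assume A: "A \<in> ?G"
    then have "finite A" "A \<subseteq> X" "card A = k" using assms(2) by (auto simp: nsets_def)
    then have "card (A - T) = k - card (A \<inter> T)" by (simp add: card_Diff_subset_Int)
    moreover have "{i \<in> X - T. i \<in> A} = A - T" using \<open>A \<subseteq> X\<close> by auto
    ultimately show "(\<Sum>i\<in>{i \<in> X - T. i \<in> A}. 1) = k - card S"
      using A by simp
  qed
  also have "\<dots> = (k - card S) * trace_card \<F> T S" by (simp add: trace_card_def)
  finally show ?thesis .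
qed

lemma pair_degree_eq_tr: "pair_degree \<F> i v = trace_card {A \<in> \<F>. i \<in> A} {v} {}"
  unfolding pair_degree_def trace_card_def by (rule arg_cong[where f = card]) auto

context large_ground
begin

lemma avoid_degree_ge:
  assumes "\<F> \<subseteq> nsets X k" "v \<in> X" and ge: "\<And>i. i \<in> X \<Longrightarrow> i \<noteq> v \<Longrightarrow> B < pair_degree \<F> i v"
  shows "36 * B \<le> trace_card \<F> {v} {}"
proof -
  have "(card X - 1) * B = (\<Sum>i\<in>X - {v}. B)"
    using assms(2) finX by simp
  also have "\<dots> \<le> (\<Sum>i\<in>X - {v}. trace_card {A \<in> \<F>. i \<in> A} {v} {})"
    using ge by (intro sum_mono) (auto simp: pair_degree_eq_tr intro: less_imp_le)
  also have "\<dots> = k * trace_card \<F> {v} {}"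
    using sum_tr_members[OF finX assms(1), of "{v}" "{}"] by simp
  finally have "(card X - 1) * B \<le> k * trace_card \<F> {v} {}" .
  moreover have "(36 * k) * B \<le> (card X - 1) * B" using large by (intro mult_le_mono1) simp
  moreover have "k * (36 * B) = (36 * k) * B" by (simp only: ac_simps)
  ultimately have "k * (36 * B) \<le> k * trace_card \<F> {v} {}" by linarith
  then show ?thesis using k3 by simp
qed

text \<open>\<open>S\<close> is disjoint from \<open>{y, c}\<close>, so the two links outside
  \<open>T\<close> cross-intersect; members with trace \<open>S\<close> avoid \<open>y\<close> and
  \<open>c\<close>, hence are few. The two choices of \<open>S\<close> are the two uniformities
  allowed in \<open>small_family_deficiency\<close>.\<close>

lemma trace_deficiency:
  assumes F: "\<F> \<subseteq> nsets X k" "intersecting \<F>" and xyc: "x \<in> X" "y \<in> X" "c \<in> X" "x \<noteq> y" "x \<noteq> c" "y \<noteq> c"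
    and small: "trace_card \<F> {y, c} {} < (card X - 5) choose (k - 3)" and T: "T = {x, y, c}"
    and S: "S = {} \<or> S = {x}"
  shows "8 * trace_card \<F> T S + trace_card \<F> T {y, c} \<le> (card X - 3) choose (k - 2)"
proof -
  let ?Y = "X - T"
  have cY: "card ?Y = card X - 3" using xyc finX by (simp add: T card_Diff_subset)
  have "8 * card (link \<F> T S) + card (link \<F> T {y, c}) \<le> card ?Y choose (k - 2)"
  proof (rule small_family_deficiency)
    show "k - card S = k - 1 \<or> k - card S = k" using S by auto
    show "link \<F> T {y, c} \<subseteq> nsets ?Y (k - 2)"
      using link_nsets[OF F(1), of T "{y, c}"] xyc by (simp add: T numeral_2_eq_2)
    show "link \<F> T S \<subseteq> nsets ?Y (k - card S)"
      using link_nsets[OF F(1), of T S] by (simp add: T)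
    show "cross_intersecting (link \<F> T {y, c}) (link \<F> T S)"
      using F(2) S xyc by (intro cross_intersecting_link) (auto simp: intersecting_iff_cross)
    have "trace_card \<F> T S \<le> trace_card \<F> {y, c} {}"
    proof (rule trace_card_mono[OF finF[OF F]])
      fix A assume A: "A \<inter> T = S"
      have "y \<notin> A \<inter> T" "c \<notin> A \<inter> T" using S xyc unfolding A by auto
      then show "A \<inter> {y, c} = {}" by (auto simp: T)
    qed
    moreover have "card X - 3 - 2 = card X - 5" by simp
    ultimately show "card (link \<F> T S) < (card ?Y - 2) choose (k - 3)"
      using small by (simp only: card_link cY)
    show "36 * k \<le> card ?Y" unfolding cY using large by simp
  qed (use finX k3 in auto)
  then show ?thesis by (simp add: card_link cY)
qed

lemma sum_pair_degree_triangle: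
  assumes F: "\<F> \<subseteq> nsets X k" and xyc: "x \<in> X" "y \<in> X" "c \<in> X" "x \<noteq> y" "x \<noteq> c" "y \<noteq> c"
    and T: "T = {x, y, c}"
  shows "(\<Sum>i\<in>X - T. pair_degree \<F> i x) =
    k * trace_card \<F> T {} + (k - 1) * (trace_card \<F> T {y} + trace_card \<F> T {c}) + (k - 2) * trace_card \<F> T {y, c}"
proof -
  have "pair_degree \<F> i x = trace_card {A \<in> \<F>. i \<in> A} T {} + trace_card {A \<in> \<F>. i \<in> A} T {y}
    + trace_card {A \<in> \<F>. i \<in> A} T {c} + trace_card {A \<in> \<F>. i \<in> A} T {y, c}" for i
  proof -
    let ?G = "{A \<in> \<F>. i \<in> A}"
    have fin: "finite ?G" using finite_nsets_subset[OF finX F] by simp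
    have "T = insert y (insert c {x})" using T by auto
    then show ?thesis
      unfolding pair_degree_eq_tr
      using trace_card_split[OF fin, of c "{x}" "{}"] trace_card_split[OF fin, of y "{c, x}" "{}"] 
        trace_card_split[OF fin, of y "{c, x}" "{c}"] xyc by simp
  qed
  then have "(\<Sum>i\<in>X - T. pair_degree \<F> i x) = (k - card {}) * trace_card \<F> T {} + (k - card {y}) * trace_card \<F> T {y}
     + (k - card {c}) * trace_card \<F> T {c} + (k - card {y, c}) * trace_card \<F> T {y, c}"
    using sum_tr_members[OF finX F, of T] by (simp add: sum.distrib T)
  then show ?thesis using xyc by (simp add: algebra_simps numeral_2_eq_2)
qed

lemma exists_small_pair_degree:
  assumes F: "\<F> \<subseteq> nsets X k" "intersecting \<F>"
  shows "\<exists>i\<in>X. \<exists>v\<in>X. i \<noteq> v \<and> pair_degree \<F> i v \<le> B"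
proof (rule ccontr)
  assume "\<not> ?thesis"
  then have big: "B < pair_degree \<F> i v" if "i \<in> X" "v \<in> X" "i \<noteq> v" for i v
    using that by (meson not_less)
  have "36 * B \<le> trace_card \<F> {v} {}" if "v \<in> X" for v
    using big that by (intro avoid_degree_ge[OF F(1)]) auto
  then obtain x y c where xyc: "x \<in> X" "y \<in> X" "c \<in> X" "x \<noteq> y" "x \<noteq> c" "y \<noteq> c"
    and sm: "trace_card \<F> {x, y} {} < (card X - 5) choose (k - 3)"
    "trace_card \<F> {x, c} {} < (card X - 5) choose (k - 3)" "trace_card \<F> {y, c} {} < (card X - 5) choose (k - 3)"
    using exists_triangle[OF F] by blast
  define T where "T = {x, y, c}"
  have T': "T = {y, x, c}" "T = {c, x, y}" by (auto simp: T_def)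
  have cT: "card (X - T) = card X - 3" using xyc finX by (simp add: T_def card_Diff_subset)
  define M where "M = (card X - 3) choose (k - 2)"
  define d0 dx dy dc ax ay ac where "d0 = trace_card \<F> T {}" and "dx = trace_card \<F> T {x}" and "dy = trace_card \<F> T {y}"
    and "dc = trace_card \<F> T {c}" and "ax = trace_card \<F> T {y, c}" and "ay = trace_card \<F> T {x, c}" and "ac = trace_card \<F> T {x, y}"
  note defs = d0_def dx_def dy_def dc_def ax_def ay_def ac_def M_def
  \<comment> \<open>Strictness is kept as \<open>Suc B\<close>; its surplus
    \<open>card X - 3\<close> is what finally contradicts.\<close>
  have lower: "(card X - 3) * Suc B \<le> (\<Sum>i\<in>X - T. pair_degree \<F> i v)" if "v \<in> T" for v
  proof -
    have "v \<in> X" using that xyc by (auto simp: T_def)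
    have "(card X - 3) * Suc B = (\<Sum>i\<in>X - T. Suc B)" by (simp add: cT)
    also have "\<dots> \<le> (\<Sum>i\<in>X - T. pair_degree \<F> i v)"
      using big \<open>v \<in> X\<close> that by (intro sum_mono) (auto simp: Suc_le_eq)
    finally show ?thesis .
  qed
  have up: "(card X - 3) * Suc B \<le> k * d0 + (k - 1) * (dy + dc) + (k - 2) * ax"
    "(card X - 3) * Suc B \<le> k * d0 + (k - 1) * (dx + dc) + (k - 2) * ay"
    "(card X - 3) * Suc B \<le> k * d0 + (k - 1) * (dx + dy) + (k - 2) * ac"
    using lower[of x] lower[of y] lower[of c] xyc
      sum_pair_degree_triangle[OF F(1), of x y c T] sum_pair_degree_triangle[OF F(1), of y x c T]
      sum_pair_degree_triangle[OF F(1), of c x y T] T' unfolding defs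
    by (simp_all add: T_def)
  have def1: "8 * d0 + ax \<le> M" "8 * dx + ax \<le> M"
    using trace_deficiency[OF F, of x y c T] xyc sm T_def unfolding defs by auto
  have def2: "8 * d0 + ay \<le> M" "8 * dy + ay \<le> M"
    using trace_deficiency[OF F, of y x c T] xyc sm T' unfolding defs by auto
  have def3: "8 * d0 + ac \<le> M" "8 * dc + ac \<le> M"
    using trace_deficiency[OF F, of c x y T] xyc sm T' unfolding defs by auto
  obtain q where q: "k = q + 3" using k3 by (metis add.commute le_Suc_ex)
  define L where "L = card X - 3"
  \<comment> \<open>Averaging the two bounds charges \<open>d0\<close> and \<open>dx\<close> at
    once. The bound on \<open>ax\<close> pays for \<open>dx\<close>, but the sum at \<open>x\<close>
    contains \<open>dy\<close> and \<open>dc\<close>; so the three points of \<open>T\<close> have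
    to be added up.\<close>
  have "4 * d0 + 4 * dx + ax \<le> M" "4 * d0 + 4 * dy + ay \<le> M" "4 * d0 + 4 * dc + ac \<le> M"
    using def1 def2 def3 by linarith+
  then have "(q + 1) * (4 * d0 + 4 * dx + ax) \<le> (q + 1) * M" "(q + 1) * (4 * d0 + 4 * dy + ay) \<le> (q + 1) * M"
    "(q + 1) * (4 * d0 + 4 * dc + ac) \<le> (q + 1) * M"
    by (simp_all only: mult_le_mono2)
  then have "4 * ((q + 1) * d0) + 4 * ((q + 1) * dx) + (q + 1) * ax \<le> (q + 1) * M"
    "4 * ((q + 1) * d0) + 4 * ((q + 1) * dy) + (q + 1) * ay \<le> (q + 1) * M"
    "4 * ((q + 1) * d0) + 4 * ((q + 1) * dc) + (q + 1) * ac \<le> (q + 1) * M"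
    by (simp_all add: algebra_simps)
  \<comment> \<open>In the total, \<open>d0\<close> has weight \<open>3 * (q + 3)\<close> against a
    loss of \<open>12 * (q + 1)\<close>, and each of \<open>dx\<close>, \<open>dy\<close>,
    \<open>dc\<close> weight \<open>2 * (q + 2)\<close> against \<open>4 * (q + 1)\<close>.\<close>
  moreover have "(q + 3) * d0 \<le> 4 * ((q + 1) * d0)"
    using mult_le_mono1[of "q + 3" "4 * (q + 1)" d0] by (simp only: mult.assoc) simp
  moreover have two: "(q + 2) * d + (q + 2) * e \<le> 2 * ((q + 1) * d) + 2 * ((q + 1) * e)" for d e
    using mult_le_mono1[of "q + 2" "2 * (q + 1)" "d + e"] by (simp add: algebra_simps)
  moreover have "L * B + L \<le> (q + 3) * d0 + ((q + 2) * dy + (q + 2) * dc) + (q + 1) * ax"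
    "L * B + L \<le> (q + 3) * d0 + ((q + 2) * dx + (q + 2) * dc) + (q + 1) * ay"
    "L * B + L \<le> (q + 3) * d0 + ((q + 2) * dx + (q + 2) * dy) + (q + 1) * ac"
    using up by (simp_all add: q L_def algebra_simps)
  \<comment> \<open>\<open>M\<close> is \<open>L choose (q + 1)\<close> and \<open>B\<close> is
    \<open>(L - 1) choose q\<close>, so the main terms cancel exactly.\<close>
  moreover have "(q + 1) * M = L * B"
  proof -
    have "card X - 3 = Suc (card X - 4)" "k - 2 = Suc q" "k - 3 = q" using large q by simp_all
    then show ?thesis using Suc_times_binomial[of q "card X - 4"] by (simp add: M_def B_def L_def)
  qed
  moreover have "0 < L" using large by (simp add: L_def)
  ultimately show False
    using two[of dy dc] two[of dx dc] two[of dx dy] by linarith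
qed

end

text \<open>Take a member inside some \<open>{1, q}\<close> through 1. A member through
  \<open>i\<close> avoiding 1 must contain \<open>q\<close>, and one through \<open>i'\<close>
  avoiding \<open>q\<close> must contain 1; having at most two elements each, they are disjoint.
  \<open>4 \<le> n\<close> leaves room for \<open>i\<close> and \<open>i'\<close> among 2, 3,
  4.\<close>

lemma exists_zero_pair_degree:
  assumes "4 \<le> n" "k \<le> 2" "\<F> \<subseteq> nsets {1..n} k" "intersecting \<F>"
  shows "\<exists>i\<in>{1..n}. \<exists>v\<in>{1..n}. i \<noteq> v \<and> pair_degree \<F> i v = 0"
proof (rule ccontr)
  assume none: "\<not> ?thesis"
  have ex: "\<exists>A\<in>\<F>. i \<in> A \<and> v \<notin> A" if "i \<in> {1..n}" "v \<in> {1..n}" "i \<noteq> v" for i v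
  proof -
    have "pair_degree \<F> i v \<noteq> 0"
    proof
      assume "pair_degree \<F> i v = 0"
      then have "\<exists>i\<in>{1..n}. \<exists>v\<in>{1..n}. i \<noteq> v \<and> pair_degree \<F> i v = 0"
        using that by (intro bexI[of _ i] bexI[of _ v]) auto
      then show False using none by contradiction
    qed
    then have "{A \<in> \<F>. i \<in> A \<and> v \<notin> A} \<noteq> {}" unfolding pair_degree_def by (metis card.empty)
    then show ?thesis by blast
  qed
  have card2: "finite A" "card A \<le> 2" if "A \<in> \<F>" for A
    using that assms(2,3) by (auto simp: nsets_def)
  have meet: "A \<inter> C \<noteq> {}" if "A \<in> \<F>" "C \<in> \<F>" for A C
    using that assms(4) by (auto simp: intersecting_def)
  have sub2: "A \<subseteq> {a, b}" if "A \<in> \<F>" "a \<in> A" "b \<in> A" "a \<noteq> b" for A a b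
  proof -
    have "{a, b} = A" using card2[OF that(1)] that by (intro card_seteq) auto
    then show ?thesis by simp
  qed
  obtain A where A: "A \<in> \<F>" "1 \<in> A" using ex[of 1 2] assms(1) by auto
  have "\<exists>q. q \<in> {2..n} \<and> A \<subseteq> {1, q}"
  proof (cases "A \<subseteq> {1}")
    case True
    then show ?thesis using assms(1) by (intro exI[of _ 2]) auto
  next
    case False
    then obtain q where "q \<in> A" "q \<noteq> 1" by blast
    moreover have "A \<subseteq> {1..n}" using A assms(3) unfolding nsets_def by blast
    ultimately have "q \<in> {1..n}" by blast
    with \<open>q \<in> A\<close> \<open>q \<noteq> 1\<close>
    show ?thesis using sub2[OF A, of q] by (intro exI[of _ q]) auto
  qed
  then obtain q where q: "q \<in> {2..n}" "A \<subseteq> {1, q}" by blast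
  have "\<exists>i\<in>{2..4}. \<exists>i'\<in>{2..4}. i \<noteq> q \<and> i' \<noteq> q \<and> i \<noteq> i'"
  proof -
    consider "q = 2" | "q = 3" | "q \<noteq> 2" "q \<noteq> 3" by blast
    then show ?thesis
    proof cases
      case 1
      then show ?thesis by (intro bexI[of _ 3] bexI[of _ 4]) auto
    next
      case 2
      then show ?thesis by (intro bexI[of _ 2] bexI[of _ 4]) auto
    next
      case 3
      then show ?thesis by (intro bexI[of _ 2] bexI[of _ 3]) auto
    qed
  qed
  then obtain i i' where i: "i \<in> {2..4}" "i' \<in> {2..4}" "i \<noteq> q" "i' \<noteq> q" "i \<noteq> i'" by blast
  obtain C where C: "C \<in> \<F>" "i \<in> C" "1 \<notin> C" using ex[of i 1] i assms(1) by auto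
  obtain D where D: "D \<in> \<F>" "i' \<in> D" "q \<notin> D" using ex[of i' q] i q assms(1) by auto
  have "q \<in> C" using meet[OF A(1) C(1)] q(2) C(3) by auto
  have "1 \<in> D" using meet[OF A(1) D(1)] q(2) D(3) by auto
  have "C \<subseteq> {i, q}" using sub2[OF C(1,2) \<open>q \<in> C\<close>] i by simp
  moreover have "D \<subseteq> {i', 1}" using sub2[OF D(1,2) \<open>1 \<in> D\<close>] i by simp
  ultimately show False using meet[OF C(1) D(1)] C(3) D(3) i by auto
qed

lemma sturdiness_le_pair_degree:
  assumes "i \<in> {1..n}" "j \<in> {1..n}" "i \<noteq> j"
  shows "sturdiness n \<F> \<le> pair_degree \<F> i j"
proof -
  let ?S = "{pair_degree \<F> i j | i j. i \<in> {1..n} \<and> j \<in> {1..n} \<and> i \<noteq> j}"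
  have "?S \<subseteq> (\<lambda>(i, j). pair_degree \<F> i j) ` ({1..n} \<times> {1..n})" by auto
  then have "finite ?S" by (rule finite_subset) simp
  then show ?thesis unfolding sturdiness_def using assms by (intro Min_le) auto
qed

theorem theorem1p5:
  fixes n k :: nat and \<F> :: "nat set set"
  assumes "n \<ge> 36 * (k + 6)"
    and "\<F> \<subseteq> nsets {1..n} k"
    and "intersecting \<F>"
  shows "sturdiness n \<F> \<le> binom (n - 4) (int k - 3)"
proof (cases "3 \<le> k")
  case True
  interpret large_ground "{1..n}" k
    using True assms(1) by unfold_locales auto
  obtain i j where "i \<in> {1..n}" "j \<in> {1..n}" "i \<noteq> j" "pair_degree \<F> i j \<le> B"
    using exists_small_pair_degree[OF assms(2,3)] by blast
  then have "sturdiness n \<F> \<le> B"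
    using sturdiness_le_pair_degree order_trans by blast
  also have "B = binom (n - 4) (int k - 3)"
    using True unfolding B_def binom_def by (simp add: nat_diff_distrib)
  finally show ?thesis .
next
  case False
  then obtain i j where "i \<in> {1..n}" "j \<in> {1..n}" "i \<noteq> j" "pair_degree \<F> i j = 0"
    using exists_zero_pair_degree[OF _ _ assms(2,3)] assms(1) by auto
  then have "sturdiness n \<F> \<le> 0" using sturdiness_le_pair_degree[of i n j \<F>] by simp
  then show ?thesis by simp
qed

end
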